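(* The robust two-stage \textsc{Representatives Selection} problem under uncertainty set $\mathcal{U}^{\mathcal{HP}}_0$ can be solved in $O(n^2\log n)$ time.
   Context: \textsc{Representatives Selection}: the set of $n$ tools $[n]$ is partitioned into disjoint sets $T_1,\dots,T_\ell$ and $\mathcal{X}=\{\mathbf{x}\in\{0,1\}^n:\sum_{i\in T_l}x_i=1,\ l\in[\ell]\}$; first-stage costs $\mathbf{C}\in\mathbb{R}^n_{\ge0}$; $\mathcal{R}(\mathbf{x})=\{\mathbf{y}\in\{0,1\}^n:\mathbf{x}+\mathbf{y}\in\mathcal{X}\}$, $\mathcal{X}'=\{\mathbf{x}\in\{0,1\}^n:\mathcal{R}(\mathbf{x})\ne\emptyset\}$; the robust two-stage problem is $\min_{\mathbf{x}\in\mathcal{X}'}\max_{\mathbf{c}\in\mathcal{U}}\min_{\mathbf{y}\in\mathcal{R}(\mathbf{x})}(\mathbf{C}^T\mathbf{x}+\mathbf{c}^T\mathbf{y})$. Here $\mathcal{U}=\mathcal{U}^{\mathcal{HP}}_0=\{\underline{\mathbf{c}}+\boldsymbol{\delta}:\mathbf{0}\le\boldsymbol{\delta}\le\mathbf{d},\ \|\boldsymbol{\delta}\|_1\le\Gamma\}$ (continuous budgeted uncertainty) with $\underline{\mathbf{c}},\mathbf{d}\in\mathbb{R}^n_{\ge0}$, $\Gamma\ge0$. *)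

theory Defs
  imports "HOL-Analysis.Analysis" "HOL-Library.Landau_Symbols"
begin

section \<open>Robust two-stage Representatives Selection\<close>

text \<open>
  The tools are \<open>0, \<dots>, n - 1\<close>. A vector of \<open>\<real>\<^sup>n\<close> is a function on \<^typ>\<open>nat\<close> that vanishes from
  \<open>n\<close> on, so that vectors of length \<open>n\<close> are equal iff their first \<open>n\<close> components are.
\<close>

definition vectors :: "nat \<Rightarrow> (nat \<Rightarrow> real) set" where
  "vectors n = {v. \<forall>i\<ge>n. v i = 0}"

definition nonneg_vectors :: "nat \<Rightarrow> (nat \<Rightarrow> real) set" where
  "nonneg_vectors n = {v \<in> vectors n. \<forall>i<n. 0 \<le> v i}"

definition binary_vectors :: "nat \<Rightarrow> (nat \<Rightarrow> real) set" where
  "binary_vectors n = {v \<in> vectors n. \<forall>i<n. v i \<in> {0, 1}}"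

definition dot :: "nat \<Rightarrow> (nat \<Rightarrow> real) \<Rightarrow> (nat \<Rightarrow> real) \<Rightarrow> real" where
  "dot n u v = (\<Sum>i<n. u i * v i)"

definition l1_norm :: "nat \<Rightarrow> (nat \<Rightarrow> real) \<Rightarrow> real" where
  "l1_norm n v = (\<Sum>i<n. \<bar>v i\<bar>)"

record instance_data =
  num_tools :: nat
  num_parts :: nat
  tool_set :: "nat \<Rightarrow> nat set"
  first_cost :: "nat \<Rightarrow> real"
  nominal_cost :: "nat \<Rightarrow> real"
  deviation :: "nat \<Rightarrow> real"
  budget :: real

definition valid_instance :: "instance_data \<Rightarrow> bool" where
  "valid_instance I \<longleftrightarrow>
     (\<Union>l<num_parts I. tool_set I l) = {..<num_tools I} \<and>
     disjoint_family_on (tool_set I) {..<num_parts I} \<and>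
     (\<forall>l<num_parts I. tool_set I l \<noteq> {}) \<and>
     first_cost I \<in> nonneg_vectors (num_tools I) \<and>
     nominal_cost I \<in> nonneg_vectors (num_tools I) \<and>
     deviation I \<in> nonneg_vectors (num_tools I) \<and>
     0 \<le> budget I"

definition feasible :: "instance_data \<Rightarrow> (nat \<Rightarrow> real) set" where
  "feasible I = {x \<in> binary_vectors (num_tools I). \<forall>l<num_parts I. (\<Sum>i\<in>tool_set I l. x i) = 1}"

definition recourse :: "instance_data \<Rightarrow> (nat \<Rightarrow> real) \<Rightarrow> (nat \<Rightarrow> real) set" where
  "recourse I x = {y \<in> binary_vectors (num_tools I). (\<lambda>i. x i + y i) \<in> feasible I}"

definition first_stage :: "instance_data \<Rightarrow> (nat \<Rightarrow> real) set" where
  "first_stage I = {x \<in> binary_vectors (num_tools I). recourse I x \<noteq> {}}"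

definition uncertainty :: "instance_data \<Rightarrow> (nat \<Rightarrow> real) set" where
  "uncertainty I = {\<lambda>i. nominal_cost I i + \<delta> i | \<delta>.
     \<delta> \<in> vectors (num_tools I) \<and>
     (\<forall>i<num_tools I. 0 \<le> \<delta> i \<and> \<delta> i \<le> deviation I i) \<and>
     l1_norm (num_tools I) \<delta> \<le> budget I}"

definition total_cost ::
    "instance_data \<Rightarrow> (nat \<Rightarrow> real) \<Rightarrow> (nat \<Rightarrow> real) \<Rightarrow> (nat \<Rightarrow> real) \<Rightarrow> real" where
  "total_cost I x c y = dot (num_tools I) (first_cost I) x + dot (num_tools I) c y"

definition recourse_value :: "instance_data \<Rightarrow> (nat \<Rightarrow> real) \<Rightarrow> (nat \<Rightarrow> real) \<Rightarrow> real" where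
  "recourse_value I x c = Min (total_cost I x c ` recourse I x)"

text \<open>
  The uncertainty set is infinite, so the maximum over it is written as a supremum; it is attained
  (lemma \<open>robust_value_attained\<close> below). The two minima range over finite nonempty sets.
\<close>

definition robust_value :: "instance_data \<Rightarrow> (nat \<Rightarrow> real) \<Rightarrow> real" where
  "robust_value I x = (SUP c\<in>uncertainty I. recourse_value I x c)"

definition optimal_value :: "instance_data \<Rightarrow> real" where
  "optimal_value I = Min (robust_value I ` first_stage I)"

lemma finite_binary_vectors: "finite (binary_vectors n)"
proof (rule finite_subset)
  show "binary_vectors n \<subseteq> (\<lambda>A i. if i \<in> A then 1 else 0) ` Pow {..<n}"
  proof
    fix v assume v: "v \<in> binary_vectors n"
    have "v = (\<lambda>i. if i \<in> {i. i < n \<and> v i = 1} then 1 else 0)"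
      using v by (auto simp: binary_vectors_def vectors_def fun_eq_iff) (metis not_less)
    then show "v \<in> (\<lambda>A i. if i \<in> A then 1 else 0) ` Pow {..<n}"
      by (intro image_eqI[where x = "{i. i < n \<and> v i = 1}"]) auto
  qed
qed simp

lemma finite_recourse: "finite (recourse I x)"
  by (rule finite_subset[OF _ finite_binary_vectors[of "num_tools I"]]) (auto simp: recourse_def)

lemma finite_first_stage: "finite (first_stage I)"
  by (rule finite_subset[OF _ finite_binary_vectors[of "num_tools I"]]) (auto simp: first_stage_def)

lemma first_stage_nonempty:
  assumes "valid_instance I"
  shows "first_stage I \<noteq> {}"
proof -
  let ?p = "tool_set I" and ?L = "{..<num_parts I}"
  define r where "r l = (SOME i. i \<in> ?p l)" for l
  have r: "r l \<in> ?p l" if "l < num_parts I" for l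
    using assms that unfolding r_def valid_instance_def by (metis ex_in_conv someI_ex)
  define x :: "nat \<Rightarrow> real" where "x i = (if i \<in> r ` ?L then 1 else 0)" for i
  have U: "(\<Union>l\<in>?L. ?p l) = {..<num_tools I}"
    and dis: "disjoint_family_on ?p ?L"
    using assms by (auto simp: valid_instance_def)
  have rn: "r l < num_tools I" if "l < num_parts I" for l
    using r[OF that] U that by blast
  have bin: "x \<in> binary_vectors (num_tools I)"
    using rn by (fastforce simp: x_def binary_vectors_def vectors_def)
  have one: "(\<Sum>i\<in>?p l. x i) = 1" if l: "l < num_parts I" for l
  proof -
    have fin: "finite (?p l)"
      using U l by (intro finite_subset[OF _ finite_lessThan[of "num_tools I"]]) blast
    have eq: "x i = (if i = r l then 1 else 0)" if i: "i \<in> ?p l" for i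
    proof -
      have "i = r l" if "k < num_parts I" "i = r k" for k
      proof -
        have "i \<in> ?p k" using r[OF that(1)] that(2) by simp
        then have "k = l"
          using i dis l that(1) unfolding disjoint_family_on_def by blast
        then show ?thesis using that(2) by simp
      qed
      then have "i \<in> r ` ?L \<longleftrightarrow> i = r l"
        using l by blast
      then show ?thesis by (simp add: x_def)
    qed
    have "(\<Sum>i\<in>?p l. x i) = (\<Sum>i\<in>?p l. if i = r l then 1 else 0)"
      using eq by (intro sum.cong) auto
    then show ?thesis using fin r[OF l] by simp
  qed
  have "(\<lambda>_. 0) \<in> recourse I x"
    using bin one by (auto simp: recourse_def feasible_def binary_vectors_def vectors_def)
  then show ?thesis using bin by (auto simp: first_stage_def)
qed

lemma nominal_in_uncertainty:
  assumes "valid_instance I"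
  shows "nominal_cost I \<in> uncertainty I"
  using assms
  by (auto simp: uncertainty_def valid_instance_def nonneg_vectors_def vectors_def l1_norm_def
      intro!: exI[of _ "\<lambda>_. 0"])

lemma continuous_on_Min_image:
  fixes f :: "'a :: topological_space \<Rightarrow> 'b \<Rightarrow> real"
  assumes "finite A" "A \<noteq> {}" "\<And>a. a \<in> A \<Longrightarrow> continuous_on S (\<lambda>c. f c a)"
  shows "continuous_on S (\<lambda>c. Min (f c ` A))"
  using assms
proof (induction A rule: finite_ne_induct)
  case (insert a A)
  then have "(\<lambda>c. Min (f c ` insert a A)) = (\<lambda>c. min (f c a) (Min (f c ` A)))"
    by (auto simp: fun_eq_iff)
  then show ?case using insert by (auto intro!: continuous_on_min)
qed simp

lemma compact_uncertainty: "compact (uncertainty I)"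
proof -
  let ?n = "num_tools I" and ?d = "\<lambda>i. if i < num_tools I then deviation I i else 0"
  let ?S = "PiE UNIV (\<lambda>i. {0..?d i})"
  have "compactin (product_topology (\<lambda>i. euclidean) UNIV) ?S"
    by (subst compactin_PiE) (auto simp: compactin_euclidean_iff)
  then have S: "compact ?S"
    by (simp add: euclidean_product_topology compactin_euclidean_iff)
  have "closed {\<delta> :: nat \<Rightarrow> real. l1_norm ?n \<delta> \<le> budget I}"
    unfolding l1_norm_def
    by (intro closed_Collect_le continuous_intros continuous_on_product_coordinates)
  then have K: "compact (?S \<inter> {\<delta>. l1_norm ?n \<delta> \<le> budget I})"
    using S by (intro compact_Int_closed)
  have *: "\<delta> \<in> ?S \<longleftrightarrow> \<delta> \<in> vectors ?n \<and> (\<forall>i<?n. 0 \<le> \<delta> i \<and> \<delta> i \<le> deviation I i)" for \<delta>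
    by (auto simp: vectors_def PiE_iff not_less split: if_splits)
  have "uncertainty I =
        (\<lambda>\<delta> i. nominal_cost I i + \<delta> i) ` (?S \<inter> {\<delta>. l1_norm ?n \<delta> \<le> budget I})"
    unfolding uncertainty_def using * by auto
  moreover have "continuous_on UNIV (\<lambda>\<delta> i. nominal_cost I i + (\<delta> i :: real))"
    by (intro continuous_on_coordinatewise_then_product continuous_intros
        continuous_on_product_coordinates)
  ultimately show ?thesis
    by (simp only: compact_continuous_image[OF continuous_on_subset[OF _ subset_UNIV] K])
qed

lemma robust_value_attained:
  assumes "valid_instance I" "x \<in> first_stage I"
  shows "\<exists>c\<in>uncertainty I. recourse_value I x c = robust_value I x \<and>
           (\<forall>c'\<in>uncertainty I. recourse_value I x c' \<le> recourse_value I x c)"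
proof -
  have "continuous_on (uncertainty I) (recourse_value I x)"
    unfolding recourse_value_def total_cost_def dot_def
    using assms(2)
    by (intro continuous_on_Min_image finite_recourse continuous_intros
        continuous_on_subset[OF continuous_on_product_coordinates subset_UNIV])
       (auto simp: first_stage_def)
  then obtain c where c: "c \<in> uncertainty I"
      "\<And>c'. c' \<in> uncertainty I \<Longrightarrow> recourse_value I x c' \<le> recourse_value I x c"
    using continuous_attains_sup[OF compact_uncertainty] nominal_in_uncertainty[OF assms(1)]
    by (metis empty_iff)
  then have "robust_value I x = recourse_value I x c"
    unfolding robust_value_def by (intro cSup_eq_maximum) auto
  then show ?thesis using c by auto
qed


section \<open>Real RAM programs\<close>

text \<open>
  Running time is counted on a real random access machine. Memory consists of named banks of natural
  numbers (used as indices and counters) and of real numbers; a program uses the finitely many banks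
  that it names. Each bank is an array of cells, and a scalar is cell \<open>0\<close> of its bank. Evaluating
  one constant, memory access, arithmetic operation, comparison or Boolean connective costs one
  time unit, as does each assignment and each branching step.

  Natural numbers can only be added, subtracted (with result \<open>0\<close> for a negative difference) and
  compared. There is no conversion between reals and natural numbers, in particular no rounding, and
  the only real constants are integers: unit-cost rounding, unit-cost multiplication of indices and
  arbitrary real constants would all make the machine unrealistically powerful.
\<close>

type_synonym bank = string

datatype iexp =
    INum nat
  | ICell bank iexp
  | IAdd iexp iexp
  | ISub iexp iexp

datatype rexp =
    RNum int
  | RCell bank iexp
  | RAdd rexp rexp
  | RSub rexp rexp
  | RMul rexp rexp
  | RDiv rexp rexp

datatype bexp =
    ILess iexp iexp
  | RLess rexp rexp
  | BNot bexp
  | BAnd bexp bexp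

datatype com =
    Skip
  | IAssign bank iexp iexp
  | RAssign bank iexp rexp
  | Seq com com
  | Cond bexp com com
  | While bexp com

record memory =
  imem :: "bank \<Rightarrow> nat \<Rightarrow> nat"
  rmem :: "bank \<Rightarrow> nat \<Rightarrow> real"

primrec ival :: "iexp \<Rightarrow> memory \<Rightarrow> nat" where
  "ival (INum k) s = k"
| "ival (ICell a e) s = imem s a (ival e s)"
| "ival (IAdd e f) s = ival e s + ival f s"
| "ival (ISub e f) s = ival e s - ival f s"

primrec rval :: "rexp \<Rightarrow> memory \<Rightarrow> real" where
  "rval (RNum k) s = of_int k"
| "rval (RCell a e) s = rmem s a (ival e s)"
| "rval (RAdd e f) s = rval e s + rval f s"
| "rval (RSub e f) s = rval e s - rval f s"
| "rval (RMul e f) s = rval e s * rval f s"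
| "rval (RDiv e f) s = rval e s / rval f s"

primrec bval :: "bexp \<Rightarrow> memory \<Rightarrow> bool" where
  "bval (ILess e f) s \<longleftrightarrow> ival e s < ival f s"
| "bval (RLess e f) s \<longleftrightarrow> rval e s < rval f s"
| "bval (BNot b) s \<longleftrightarrow> \<not> bval b s"
| "bval (BAnd b b') s \<longleftrightarrow> bval b s \<and> bval b' s"

primrec icost :: "iexp \<Rightarrow> nat" where
  "icost (INum k) = 1"
| "icost (ICell a e) = icost e + 1"
| "icost (IAdd e f) = icost e + icost f + 1"
| "icost (ISub e f) = icost e + icost f + 1"

primrec rcost :: "rexp \<Rightarrow> nat" where
  "rcost (RNum k) = 1"
| "rcost (RCell a e) = icost e + 1"
| "rcost (RAdd e f) = rcost e + rcost f + 1"
| "rcost (RSub e f) = rcost e + rcost f + 1"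
| "rcost (RMul e f) = rcost e + rcost f + 1"
| "rcost (RDiv e f) = rcost e + rcost f + 1"

primrec bcost :: "bexp \<Rightarrow> nat" where
  "bcost (ILess e f) = icost e + icost f + 1"
| "bcost (RLess e f) = rcost e + rcost f + 1"
| "bcost (BNot b) = bcost b + 1"
| "bcost (BAnd b b') = bcost b + bcost b' + 1"

definition iwrite :: "bank \<Rightarrow> nat \<Rightarrow> nat \<Rightarrow> memory \<Rightarrow> memory" where
  "iwrite a j v s = s\<lparr>imem := (imem s)(a := (imem s a)(j := v))\<rparr>"

definition rwrite :: "bank \<Rightarrow> nat \<Rightarrow> real \<Rightarrow> memory \<Rightarrow> memory" where
  "rwrite a j v s = s\<lparr>rmem := (rmem s)(a := (rmem s a)(j := v))\<rparr>"

text \<open>\<open>run p s t s'\<close>: started in memory \<open>s\<close>, program \<open>p\<close> halts after \<open>t\<close> time units in memory \<open>s'\<close>.\<close>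

inductive run :: "com \<Rightarrow> memory \<Rightarrow> nat \<Rightarrow> memory \<Rightarrow> bool" where
  Skip: "run Skip s 1 s"
| IAssign: "run (IAssign a e f) s (icost e + icost f + 1) (iwrite a (ival e s) (ival f s) s)"
| RAssign: "run (RAssign a e f) s (icost e + rcost f + 1) (rwrite a (ival e s) (rval f s) s)"
| Seq: "run p s t s' \<Longrightarrow> run q s' t' s'' \<Longrightarrow> run (Seq p q) s (t + t') s''"
| CondTrue: "bval b s \<Longrightarrow> run p s t s' \<Longrightarrow> run (Cond b p q) s (bcost b + 1 + t) s'"
| CondFalse: "\<not> bval b s \<Longrightarrow> run q s t s' \<Longrightarrow> run (Cond b p q) s (bcost b + 1 + t) s'"
| WhileFalse: "\<not> bval b s \<Longrightarrow> run (While b p) s (bcost b + 1) s"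
| WhileTrue: "bval b s \<Longrightarrow> run p s t s' \<Longrightarrow> run (While b p) s' t' s'' \<Longrightarrow>
    run (While b p) s (bcost b + 1 + t + t') s''"

inductive_cases run_SkipE: "run Skip s t s'"
inductive_cases run_IAssignE: "run (IAssign a e f) s t s'"
inductive_cases run_RAssignE: "run (RAssign a e f) s t s'"
inductive_cases run_SeqE: "run (Seq p q) s t s'"
inductive_cases run_CondE: "run (Cond b p q) s t s'"
inductive_cases run_WhileE: "run (While b p) s t s'"

lemma run_deterministic:
  "run p s t s' \<Longrightarrow> run p s u s'' \<Longrightarrow> u = t \<and> s'' = s'"
proof (induction arbitrary: u s'' rule: run.induct)
  case (Seq p s t s' q t' r)
  from Seq.prems show ?case by (rule run_SeqE) (auto dest!: Seq.IH)
next
  case (CondTrue b s p t s' q)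
  from CondTrue.prems show ?case
    by (rule run_CondE) (use CondTrue.hyps in \<open>auto dest!: CondTrue.IH\<close>)
next
  case (CondFalse b s q t s' p)
  from CondFalse.prems show ?case
    by (rule run_CondE) (use CondFalse.hyps in \<open>auto dest!: CondFalse.IH\<close>)
next
  case (WhileTrue b s p t s' t' r)
  from WhileTrue.prems show ?case
    by (rule run_WhileE) (use WhileTrue.hyps in \<open>auto dest!: WhileTrue.IH\<close>)
qed (auto elim: run_SkipE run_IAssignE run_RAssignE run_WhileE)


section \<open>Solving an instance\<close>

text \<open>
  The partition is given to the program by listing, for every tool, the index of the set that
  contains it. Memory that does not hold input may have arbitrary initial contents.
\<close>

definition encodes :: "memory \<Rightarrow> instance_data \<Rightarrow> bool" where
  "encodes s I \<longleftrightarrow>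
     imem s ''n'' 0 = num_tools I \<and>
     imem s ''l'' 0 = num_parts I \<and>
     (\<forall>l<num_parts I. \<forall>i\<in>tool_set I l. imem s ''part'' i = l) \<and>
     (\<forall>i<num_tools I. rmem s ''C'' i = first_cost I i) \<and>
     (\<forall>i<num_tools I. rmem s ''c'' i = nominal_cost I i) \<and>
     (\<forall>i<num_tools I. rmem s ''d'' i = deviation I i) \<and>
     rmem s ''Gamma'' 0 = budget I"

definition holds_solution :: "memory \<Rightarrow> instance_data \<Rightarrow> bool" where
  "holds_solution s I \<longleftrightarrow>
     (\<exists>x\<in>first_stage I. robust_value I x = optimal_value I \<and>
        (\<forall>i<num_tools I. rmem s ''x'' i = x i)) \<and>
     rmem s ''opt'' 0 = optimal_value I"

definition solves_within :: "com \<Rightarrow> instance_data \<Rightarrow> nat \<Rightarrow> bool" where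
  "solves_within p I b \<longleftrightarrow>
     (\<forall>s. encodes s I \<longrightarrow> (\<exists>t s'. run p s t s' \<and> t \<le> b \<and> holds_solution s' I))"

end

theory Submission
  imports Defs
begin

text \<open>
  For a fixed first stage the adversary chooses, for every part \<open>l\<close> left open, a level \<open>t\<^sub>l\<close> to which the
  cheapest tool is raised, at cost \<open>g\<^sub>l(t) = \<Sum>i\<in>T\<^sub>l. max 0 (t - c\<^sub>i)\<close>, subject to one joint budget \<open>\<Gamma>\<close> and
  to the caps \<open>u\<^sub>l = Min (c\<^sub>i + d\<^sub>i)\<close>. The \<open>g\<^sub>l\<close> are convex and piecewise linear with integer slopes at
  most \<open>n\<close>, so an optimal Lagrange multiplier of the budget is \<open>0\<close> or \<open>1 / k\<close> with \<open>1 \<le> k \<le> n\<close>. By duality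
  the problem becomes the minimisation over these \<open>n + 1\<close> multipliers \<open>\<lambda>\<close> of
  \<open>\<lambda>\<Gamma> + \<Sum>l. min (Min C\<^sub>i) (Max (t - \<lambda> g\<^sub>l(t)))\<close>: the first stage decides independently for each part.
  The inner maximum is attained at \<open>u\<^sub>l\<close> or some \<open>min c\<^sub>i u\<^sub>l\<close>. The values of \<open>g\<^sub>l\<close> there do not depend on
  \<open>\<lambda>\<close> and are tabulated in quadratic time, after which each multiplier takes linear time, without sorting.
\<close>

section \<open>Duality for one budget\<close>

text \<open>\<open>raise_cost S c t\<close> is the budget needed to raise the minimum of \<open>c\<close> over \<open>S\<close> to \<open>t\<close>, and
  \<open>cap S c d\<close> is the largest minimum that the deviations allow.\<close>

definition raise_cost :: "nat set \<Rightarrow> (nat \<Rightarrow> real) \<Rightarrow> real \<Rightarrow> real" where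
  "raise_cost S c t = (\<Sum>i\<in>S. max 0 (t - c i))"

definition cap :: "nat set \<Rightarrow> (nat \<Rightarrow> real) \<Rightarrow> (nat \<Rightarrow> real) \<Rightarrow> real" where
  "cap S c d = Min ((\<lambda>i. c i + d i) ` S)"

text \<open>The breakpoints of the piecewise linear \<open>raise_cost S c\<close> up to the cap, and
  the cap. Breakpoints beyond the cap are truncated, so that every tool contributes exactly one
  level and the program can store one per tool.\<close>

definition levels :: "nat set \<Rightarrow> (nat \<Rightarrow> real) \<Rightarrow> (nat \<Rightarrow> real) \<Rightarrow> real set" where
  "levels S c d = insert (cap S c d) ((\<lambda>i. min (c i) (cap S c d)) ` S)"

text \<open>The Lagrange multiplier of the budget is \<open>1 / k\<close>. As \<open>1 / 0 = 0\<close>, the index \<open>k = 0\<close> stands for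
  the multiplier \<open>0\<close>.\<close>

definition dual_gain :: "nat set \<Rightarrow> (nat \<Rightarrow> real) \<Rightarrow> (nat \<Rightarrow> real) \<Rightarrow> nat \<Rightarrow> real" where
  "dual_gain S c d k = Max ((\<lambda>p. p - raise_cost S c p / real k) ` levels S c d)"

section \<open>Slopes of the raising cost\<close>

lemma sum_if_card: "finite S \<Longrightarrow> (\<Sum>i\<in>S. if P i then x else 0) = real (card {i\<in>S. P i}) * x"
  by (simp add: sum.If_cases Int_def)

text \<open>A summand with \<open>c i \<ge> t\<close> vanishes at both ends, and any other grows by
  at most \<open>t - s\<close>. The cardinality is the left slope at \<open>t\<close>.\<close>

lemma raise_cost_diff_le:
  assumes "finite S" "s \<le> t"
  shows "raise_cost S c t - raise_cost S c s \<le> real (card {i\<in>S. c i < t}) * (t - s)"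
  unfolding raise_cost_def sum_subtractf[symmetric] sum_if_card[OF assms(1), symmetric]
  using assms(2) by (intro sum_mono) auto

text \<open>A summand with \<open>c i \<le> s\<close> grows by exactly \<open>t - s\<close>, and no
  other decreases. The cardinality is the right slope at \<open>s\<close>.\<close>

lemma raise_cost_diff_ge:
  assumes "finite S" "s \<le> t"
  shows "real (card {i\<in>S. c i \<le> s}) * (t - s) \<le> raise_cost S c t - raise_cost S c s"
  unfolding raise_cost_def sum_subtractf[symmetric] sum_if_card[OF assms(1), symmetric]
  using assms(2) by (intro sum_mono) auto

text \<open>First-order optimality for a concave function: \<open>k\<close> lies between the left
  and the right slope of \<open>raise_cost\<close> at \<open>t\<close>, or \<open>t\<close> is the
  right endpoint \<open>u\<close>, where the bound on the left slope suffices.\<close>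

lemma raise_cost_maximal:
  assumes S: "finite S" and k: "0 < k"
    and lo: "card {i\<in>S. c i < t} \<le> k"
    and hi: "t = u \<or> k \<le> card {i\<in>S. c i \<le> t}"
    and s: "s \<le> u"
  shows "s - raise_cost S c s / real k \<le> t - raise_cost S c t / real k"
proof (cases "s \<le> t")
  case True
  have "real (card {i\<in>S. c i < t}) * (t - s) \<le> real k * (t - s)"
    using lo True by (intro mult_right_mono) auto
  then have "raise_cost S c t - raise_cost S c s \<le> real k * (t - s)"
    using raise_cost_diff_le[OF S True, of c] by linarith
  then have "(raise_cost S c t - raise_cost S c s) / real k \<le> t - s"
    using k by (simp add: divide_le_eq mult.commute)
  then show ?thesis by (simp add: diff_divide_distrib)
next
  case False
  then have "k \<le> card {i\<in>S. c i \<le> t}" using hi s by auto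
  then have "real k * (s - t) \<le> real (card {i\<in>S. c i \<le> t}) * (s - t)"
    using False by (intro mult_right_mono) auto
  then have "real k * (s - t) \<le> raise_cost S c s - raise_cost S c t"
    using raise_cost_diff_ge[OF S, of t s c] False by linarith
  then have "s - t \<le> (raise_cost S c s - raise_cost S c t) / real k"
    using k by (simp add: le_divide_eq mult.commute)
  then show ?thesis by (simp add: diff_divide_distrib)
qed

section \<open>Levels and dual gain of a single part\<close>

locale part =
  fixes S :: "nat set" and c d :: "nat \<Rightarrow> real"
  assumes finite: "finite S" and nonempty: "S \<noteq> {}" and d_nonneg: "\<And>i. i \<in> S \<Longrightarrow> 0 \<le> d i"
begin

abbreviation "u \<equiv> cap S c d"

lemma cap_le: "i \<in> S \<Longrightarrow> u \<le> c i + d i"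
  unfolding cap_def using finite by (intro Min_le) auto

lemma finite_levels: "finite (levels S c d)" and cap_in_levels: "u \<in> levels S c d"
  using finite by (auto simp: levels_def)

lemma level_le_cap: "p \<in> levels S c d \<Longrightarrow> p \<le> u"
  by (auto simp: levels_def)

text \<open>As deviations are nonnegative, the cap is at least the cheapest cost, which is therefore
  not truncated. No tool lies strictly below this level, so the maximum that defines
  \<open>level\<close> is over a nonempty set.\<close>

lemma Min_in_levels: "Min (c ` S) \<in> levels S c d"
proof -
  obtain i where i: "i \<in> S" "Min (c ` S) = c i"
    using Min_in[of "c ` S"] finite nonempty by blast
  have "Min (c ` S) \<le> c j + d j" if "j \<in> S" for j
  proof -
    have "Min (c ` S) \<le> c j" using finite that by (intro Min_le) auto
    then show ?thesis using d_nonneg[OF that] by simp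
  qed
  then have "Min (c ` S) \<le> u"
    unfolding cap_def using finite nonempty by (intro Min.boundedI) auto
  then show ?thesis using i by (auto simp: levels_def min_def)
qed

text \<open>The slope of \<open>raise_cost S c\<close> is at most \<open>k\<close> up to \<open>level k\<close> and exceeds \<open>k\<close> beyond it, unless
  \<open>level k\<close> is the cap.\<close>

definition level :: "nat \<Rightarrow> real" where
  "level k = Max {p \<in> levels S c d. card {i\<in>S. c i < p} \<le> k}"

lemma level_props:
  shows level_in: "level k \<in> levels S c d"
    and level_card: "card {i\<in>S. c i < level k} \<le> k"
    and level_max: "\<And>p. p \<in> levels S c d \<Longrightarrow> card {i\<in>S. c i < p} \<le> k \<Longrightarrow> p \<le> level k"
proof -
  let ?A = "{p \<in> levels S c d. card {i\<in>S. c i < p} \<le> k}"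
  have fin: "finite ?A" using finite_levels by simp
  have "{i\<in>S. c i < Min (c ` S)} = {}" using finite by (auto simp: not_less)
  then have "card {i\<in>S. c i < Min (c ` S)} \<le> k" by (metis card.empty le0)
  then have "?A \<noteq> {}" using Min_in_levels by blast
  then have "level k \<in> ?A" unfolding level_def using fin by (intro Max_in)
  then show "level k \<in> levels S c d" "card {i\<in>S. c i < level k} \<le> k" by auto
  show "p \<le> level k" if "p \<in> levels S c d" "card {i\<in>S. c i < p} \<le> k" for p
    unfolding level_def using fin that by (intro Max_ge) auto
qed

text \<open>If \<open>level k\<close> is below the cap and at most \<open>k\<close> tools are at or
  below it, then the next larger level has the same tools strictly below it, since no breakpoint
  lies between neighbouring levels. It would contradict the maximality of
  \<open>level k\<close>.\<close>

lemma level_next: "level k = u \<or> Suc k \<le> card {i\<in>S. c i \<le> level k}"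
proof (rule disjCI)
  assume nk: "\<not> Suc k \<le> card {i\<in>S. c i \<le> level k}"
  show "level k = u"
  proof (rule ccontr)
    assume "level k \<noteq> u"
    then have lt: "level k < u" using level_le_cap[OF level_in] by (simp add: less_le)
    let ?B = "{p \<in> levels S c d. level k < p}"
    have B: "finite ?B" "?B \<noteq> {}" using finite_levels lt cap_in_levels by auto
    then have m: "Min ?B \<in> ?B" by (rule Min_in)
    have "{i\<in>S. c i < Min ?B} \<subseteq> {i\<in>S. c i \<le> level k}"
    proof
      fix i assume i: "i \<in> {i\<in>S. c i < Min ?B}"
      then have "c i < u" using m level_le_cap by fastforce
      then have "c i \<in> levels S c d" using i by (auto simp: levels_def min_def)
      moreover have "c i \<notin> ?B"
        using i Min_le[OF B(1), of "c i"] by (auto simp: not_le)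
      ultimately show "i \<in> {i\<in>S. c i \<le> level k}" using i by auto
    qed
    then have "card {i\<in>S. c i < Min ?B} \<le> k"
      using nk card_mono[of "{i\<in>S. c i \<le> level k}" "{i\<in>S. c i < Min ?B}"] finite by auto
    then show False using level_max[of "Min ?B" k] m by auto
  qed
qed

lemma level_mono: "j \<le> k \<Longrightarrow> level j \<le> level k"
  using level_max[OF level_in, of j k] level_card[of j] by auto

lemma level_eq_cap: "card S \<le> k \<Longrightarrow> level k = u"
proof -
  assume "card S \<le> k"
  then have "card {i\<in>S. c i < u} \<le> k"
    using card_mono[OF finite, of "{i\<in>S. c i < u}"] by auto
  then show "level k = u"
    using level_max[OF cap_in_levels] level_le_cap[OF level_in, of k] by (simp add: antisym)
qed

text \<open>Shows that index \<open>0\<close> never overruns a nonnegative budget, so the first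
  index that does has a predecessor.\<close>

lemma level_0: "raise_cost S c (level 0) = 0"
proof -
  have "{i\<in>S. c i < level 0} = {}" using level_card[of 0] finite by simp
  then show ?thesis unfolding raise_cost_def by (intro sum.neutral) auto
qed

text \<open>Between \<open>level k\<close> and \<open>level (Suc k)\<close> the slope is exactly
  \<open>Suc k\<close>, so the Lagrangian for the multiplier \<open>1 / Suc k\<close> is constant
  there. This freedom in \<open>t\<close> is what strong duality uses.\<close>

lemma level_optimal:
  assumes "level k \<le> t" "t \<le> level (Suc k)" "s \<le> u"
  shows "s - raise_cost S c s / real (Suc k) \<le> t - raise_cost S c t / real (Suc k)"
proof (rule raise_cost_maximal[OF finite _ _ _ assms(3)])
  have "card {i\<in>S. c i < t} \<le> card {i\<in>S. c i < level (Suc k)}"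
    using finite assms by (intro card_mono) auto
  then show "card {i\<in>S. c i < t} \<le> Suc k" using level_card[of "Suc k"] by simp
  have "card {i\<in>S. c i \<le> level k} \<le> card {i\<in>S. c i \<le> t}"
    using finite assms by (intro card_mono) auto
  moreover have "t = u" if "level k = u"
    using that assms level_le_cap[OF level_in, of "Suc k"] by simp
  ultimately show "t = u \<or> Suc k \<le> card {i\<in>S. c i \<le> t}" using level_next[of k] by auto
qed simp

text \<open>The finitely many levels already give the maximum over all \<open>t\<close> up to the
  cap: for \<open>k = 0\<close>, where the quotient is \<open>0\<close>, the cap is a maximiser, and
  otherwise \<open>level k\<close> is.\<close>

lemma dual_gain_ge:
  assumes "t \<le> u"
  shows "t - raise_cost S c t / real k \<le> dual_gain S c d k"
proof -
  have ge: "p - raise_cost S c p / real k \<le> dual_gain S c d k" if "p \<in> levels S c d" for p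
    unfolding dual_gain_def using finite_levels that by (intro Max_ge) auto
  show ?thesis
  proof (cases k)
    case 0
    then show ?thesis using ge[OF cap_in_levels] assms by simp
  next
    case (Suc j)
    then show ?thesis
      using level_optimal[of j "level (Suc j)" t] level_mono[of j "Suc j"] assms
        ge[OF level_in, of "Suc j"] by simp
  qed
qed

lemma dual_gain_Suc:
  assumes "level k \<le> t" "t \<le> level (Suc k)"
  shows "dual_gain S c d (Suc k) \<le> t - raise_cost S c t / real (Suc k)"
  unfolding dual_gain_def
  using finite_levels cap_in_levels level_optimal[OF assms] level_le_cap
  by (intro Max.boundedI) auto

lemma dual_gain_0: "dual_gain S c d 0 = u"
  unfolding dual_gain_def using finite_levels cap_in_levels level_le_cap
  by (intro Max_eqI) auto

text \<open>Reaching the minimum \<open>t\<close> forces every cheaper tool up to \<open>t\<close>,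
  so \<open>\<delta>\<close> spends at least \<open>raise_cost S c t\<close>. For
  \<open>k = 0\<close> both quotients vanish and the bound is the cap.\<close>

lemma weak_duality:
  assumes \<delta>: "\<And>i. i \<in> S \<Longrightarrow> 0 \<le> \<delta> i \<and> \<delta> i \<le> d i"
  shows "Min ((\<lambda>i. c i + \<delta> i) ` S) \<le> dual_gain S c d k + sum \<delta> S / real k"
proof -
  define t where "t = Min ((\<lambda>i. c i + \<delta> i) ` S)"
  have t: "t \<le> c i + \<delta> i" if "i \<in> S" for i
    unfolding t_def using finite that by (intro Min_le) auto
  have "t \<le> u"
    unfolding cap_def using finite nonempty t \<delta> by (intro Min.boundedI) force+
  then have "t - raise_cost S c t / real k \<le> dual_gain S c d k" by (rule dual_gain_ge)
  moreover have "raise_cost S c t \<le> sum \<delta> S"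
    unfolding raise_cost_def using t \<delta> by (intro sum_mono) force
  then have "raise_cost S c t / real k \<le> sum \<delta> S / real k" by (rule divide_right_mono) simp
  ultimately show ?thesis by (simp add: t_def)
qed

end

section \<open>Strong duality for parts that share a budget\<close>

lemma continuous_raise_cost: "continuous_on A f \<Longrightarrow> continuous_on A (\<lambda>x. raise_cost S c (f x))"
  unfolding raise_cost_def by (intro continuous_intros)

text \<open>If \<open>k\<close> is the first index for which the levels \<open>level k\<close> overrun the budget, then every point
  between \<open>level (k - 1)\<close> and \<open>level k\<close> is optimal for the multiplier \<open>1 / k\<close>, and by the intermediate
  value theorem some interpolation of the two spends the budget exactly.\<close>

lemma strong_duality:
  fixes T :: "nat \<Rightarrow> nat set"
  assumes L: "finite L" and dis: "disjoint_family_on T L"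
    and part: "\<And>l. l \<in> L \<Longrightarrow> part (T l) d" and card: "\<And>l. l \<in> L \<Longrightarrow> card (T l) \<le> n"
    and \<Gamma>: "0 \<le> \<Gamma>"
  shows "\<exists>k\<le>n. \<exists>\<delta>. (\<forall>i. 0 \<le> \<delta> i) \<and> (\<forall>i. i \<notin> (\<Union>l\<in>L. T l) \<longrightarrow> \<delta> i = 0) \<and>
    (\<forall>l\<in>L. \<forall>i\<in>T l. \<delta> i \<le> d i) \<and> sum \<delta> (\<Union>l\<in>L. T l) \<le> \<Gamma> \<and>
    \<Gamma> / real k + (\<Sum>l\<in>L. dual_gain (T l) c d k) \<le> (\<Sum>l\<in>L. Min ((\<lambda>i. c i + \<delta> i) ` T l))"
proof -
  let ?g = "\<lambda>l. raise_cost (T l) c"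
  let ?level = "\<lambda>k l. part.level (T l) c d k"
  have "\<exists>k\<le>n. \<exists>t. (\<forall>l\<in>L. t l \<le> cap (T l) c d) \<and> (\<Sum>l\<in>L. ?g l (t l)) \<le> \<Gamma> \<and>
     \<Gamma> / real k + (\<Sum>l\<in>L. dual_gain (T l) c d k) \<le> (\<Sum>l\<in>L. t l)"
  proof (cases "(\<Sum>l\<in>L. ?g l (?level n l)) \<le> \<Gamma>")
    \<comment> \<open>The budget pays for raising every part to its cap, so the multiplier
      \<open>0\<close> is optimal.\<close>
    case True
    have "(\<Sum>l\<in>L. dual_gain (T l) c d 0) = (\<Sum>l\<in>L. ?level n l)"
      using part card by (intro sum.cong) (auto simp: part.dual_gain_0 part.level_eq_cap)
    then show ?thesis
      using True part card
      by (intro exI[of _ 0] exI[of _ "?level n"] conjI) (auto simp: part.level_eq_cap)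
  next
    case False
    define k where "k = (LEAST k. \<Gamma> < (\<Sum>l\<in>L. ?g l (?level k l)))"
    have k: "\<Gamma> < (\<Sum>l\<in>L. ?g l (?level k l))" "k \<le> n"
      unfolding k_def using False by (auto intro: LeastI Least_le simp: not_le)
    have "(\<Sum>l\<in>L. ?g l (?level 0 l)) = 0"
      using part by (intro sum.neutral) (auto simp: part.level_0)
    then obtain j where j: "k = Suc j" using k(1) \<Gamma> by (cases k) auto
    have "\<not> \<Gamma> < (\<Sum>l\<in>L. ?g l (?level j l))"
      by (rule not_less_Least) (use j in \<open>simp flip: k_def\<close>)
    then have jl: "(\<Sum>l\<in>L. ?g l (?level j l)) \<le> \<Gamma>" by simp
    define t where "t \<theta> l = ?level j l + \<theta> * (?level k l - ?level j l)" for \<theta> l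
    have "\<exists>\<theta>\<ge>0. \<theta> \<le> 1 \<and> (\<Sum>l\<in>L. ?g l (t \<theta> l)) = \<Gamma>"
      using jl k(1) unfolding t_def
      by (intro IVT') (auto intro!: continuous_on_sum continuous_raise_cost continuous_intros)
    then obtain \<theta> where \<theta>: "0 \<le> \<theta>" "\<theta> \<le> 1" "(\<Sum>l\<in>L. ?g l (t \<theta> l)) = \<Gamma>" by blast
    have t: "?level j l \<le> t \<theta> l" "t \<theta> l \<le> ?level k l" if "l \<in> L" for l
    proof -
      have jk: "?level j l \<le> ?level k l" using part.level_mono[OF part[OF that]] j by simp
      then show "?level j l \<le> t \<theta> l" using \<theta> by (simp add: t_def)
      have "\<theta> * (?level k l - ?level j l) \<le> 1 * (?level k l - ?level j l)"
        using jk \<theta> by (intro mult_right_mono) auto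
      then show "t \<theta> l \<le> ?level k l" by (simp add: t_def)
    qed
    have "(\<Sum>l\<in>L. dual_gain (T l) c d k) \<le> (\<Sum>l\<in>L. t \<theta> l - ?g l (t \<theta> l) / real k)"
      using t j by (intro sum_mono) (simp only: part.dual_gain_Suc[OF part])
    also have "\<dots> = (\<Sum>l\<in>L. t \<theta> l) - \<Gamma> / real k"
      by (simp add: sum_subtractf \<theta>(3) flip: sum_divide_distrib)
    finally show ?thesis
      using k(2) \<theta>(3) t part.level_le_cap[OF part part.level_in[OF part]]
      by (intro exI[of _ k] exI[of _ "t \<theta>"] conjI) (auto, meson order_trans)
  qed
  then obtain k t where k: "k \<le> n" and t: "\<And>l. l \<in> L \<Longrightarrow> t l \<le> cap (T l) c d"
      "(\<Sum>l\<in>L. ?g l (t l)) \<le> \<Gamma>"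
      "\<Gamma> / real k + (\<Sum>l\<in>L. dual_gain (T l) c d k) \<le> (\<Sum>l\<in>L. t l)"
    by blast
  \<comment> \<open>Every tool cheaper than the target of its part is raised exactly to the target,
    which costs \<open>raise_cost\<close> in total. \<open>THE\<close> recovers the part of a tool,
    unique by disjointness.\<close>
  define \<delta> where "\<delta> i = (if \<exists>l\<in>L. i \<in> T l then max 0 (t (THE l. l \<in> L \<and> i \<in> T l) - c i) else 0)" for i
  have \<delta>: "\<delta> i = max 0 (t l - c i)" if "l \<in> L" "i \<in> T l" for l i
  proof -
    have "(THE l. l \<in> L \<and> i \<in> T l) = l"
      using that dis by (intro the_equality) (auto simp: disjoint_family_on_def)
    then show ?thesis using that by (auto simp: \<delta>_def)
  qed
  have "sum \<delta> (\<Union>l\<in>L. T l) = (\<Sum>l\<in>L. sum \<delta> (T l))"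
    using L dis part by (intro sum.UNION_disjoint) (auto simp: part_def disjoint_family_on_def)
  also have "\<dots> = (\<Sum>l\<in>L. ?g l (t l))"
    unfolding raise_cost_def by (intro sum.cong refl) (simp add: \<delta>)
  finally have s: "sum \<delta> (\<Union>l\<in>L. T l) \<le> \<Gamma>" using t by simp
  have m: "(\<Sum>l\<in>L. t l) \<le> (\<Sum>l\<in>L. Min ((\<lambda>i. c i + \<delta> i) ` T l))"
  proof (rule sum_mono)
    fix l assume l: "l \<in> L"
    show "t l \<le> Min ((\<lambda>i. c i + \<delta> i) ` T l)"
      using part[OF l] \<delta>[OF l] by (intro Min.boundedI) (auto simp: part_def)
  qed
  have "\<delta> i \<le> d i" if "l \<in> L" "i \<in> T l" for l i
    using t(1)[OF that(1)] part.cap_le[OF part[OF that(1)] that(2), of c]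
      part.d_nonneg[OF part[OF that(1)] that(2)] \<delta>[OF that] by auto
  then show ?thesis
    using k t(3) m s by (intro exI[of _ k] conjI exI[of _ \<delta>]) (auto simp: \<delta>_def)
qed

section \<open>Reduction to a minimum over multipliers\<close>

text \<open>The indicator vector of the representatives \<open>a l\<close> with
  \<open>l \<in> A\<close>. It serves both as a first stage and as a recourse.\<close>

definition selection :: "(nat \<Rightarrow> nat) \<Rightarrow> nat set \<Rightarrow> nat \<Rightarrow> real" where
  "selection a A i = (if i \<in> a ` A then 1 else 0)"

definition dual_value :: "instance_data \<Rightarrow> nat \<Rightarrow> real" where
  "dual_value I k = budget I / real k + (\<Sum>l<num_parts I.
     min (Min (first_cost I ` tool_set I l))
         (dual_gain (tool_set I l) (nominal_cost I) (deviation I) k))"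

definition open_parts :: "instance_data \<Rightarrow> (nat \<Rightarrow> real) \<Rightarrow> nat set" where
  "open_parts I x = {l. l < num_parts I \<and> (\<Sum>i\<in>tool_set I l. x i) = 0}"

section \<open>Sums over the partition\<close>

locale rs_instance =
  fixes I :: instance_data
  assumes valid: "valid_instance I"
begin

abbreviation "n \<equiv> num_tools I"
abbreviation "parts \<equiv> {..<num_parts I}"
abbreviation "T \<equiv> tool_set I"
abbreviation "C \<equiv> first_cost I"
abbreviation "c \<equiv> nominal_cost I"
abbreviation "d \<equiv> deviation I"
abbreviation "gain l k \<equiv> dual_gain (T l) c d k"

lemma Union_T: "(\<Union>l\<in>parts. T l) = {..<n}"
  and disjoint_T: "disjoint_family_on T parts"
  and T_nonempty: "l \<in> parts \<Longrightarrow> T l \<noteq> {}"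
  and budget_nonneg: "0 \<le> budget I"
  using valid by (auto simp: valid_instance_def)

lemma T_subset: "l \<in> parts \<Longrightarrow> T l \<subseteq> {..<n}"
  using Union_T by blast

lemma finite_T: "l \<in> parts \<Longrightarrow> finite (T l)"
  using T_subset finite_subset by blast

lemma T_unique: "l \<in> parts \<Longrightarrow> l' \<in> parts \<Longrightarrow> i \<in> T l \<Longrightarrow> i \<in> T l' \<Longrightarrow> l = l'"
  using disjoint_T by (auto simp: disjoint_family_on_def)

lemma part_T: "l \<in> parts \<Longrightarrow> part (T l) d"
  using valid T_subset finite_T T_nonempty
  by (unfold_locales) (auto simp: valid_instance_def nonneg_vectors_def)

lemma card_T_le: "l \<in> parts \<Longrightarrow> card (T l) \<le> n"
  using card_mono[OF _ T_subset] by simp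

text \<open>Choosing a tool from each part is injective. This lets loops over the parts be charged
  as \<open>n\<close> iterations.\<close>

lemma num_parts_le: "num_parts I \<le> n"
proof -
  define r where "r l = (SOME i. i \<in> T l)" for l
  have r: "r l \<in> T l" if "l \<in> parts" for l
    using T_nonempty[OF that] by (auto simp: r_def some_in_eq)
  then have "inj_on r parts" using T_unique by (intro inj_onI) metis
  moreover have "r ` parts \<subseteq> {..<n}" using r T_subset by blast
  ultimately show ?thesis using card_inj_on_le[of r parts "{..<n}"] by simp
qed

lemma sum_parts: "(\<Sum>i<n. f i) = (\<Sum>l\<in>parts. sum f (T l))"
  unfolding Union_T[symmetric] using finite_T T_unique
  by (intro sum.UNION_disjoint) auto

lemma dot_parts: "dot n w x = (\<Sum>l\<in>parts. \<Sum>i\<in>T l. w i * x i)"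
  by (simp add: dot_def sum_parts)

text \<open>By disjointness \<open>a l\<close> is the only representative that can lie in
  \<open>T l\<close>, so at most one term survives.\<close>

lemma sum_selection:
  assumes "l \<in> parts" "A \<subseteq> parts" "\<And>l. l \<in> parts \<Longrightarrow> a l \<in> T l"
  shows "(\<Sum>i\<in>T l. w i * selection a A i) = (if l \<in> A then w (a l) else 0)"
proof -
  have "w i * selection a A i = (if i = a l then if l \<in> A then w (a l) else 0 else 0)"
    if "i \<in> T l" for i
    using assms T_unique that by (auto simp: selection_def subset_iff image_iff) metis+
  then have "(\<Sum>i\<in>T l. w i * selection a A i) =
      (\<Sum>i\<in>T l. if i = a l then if l \<in> A then w (a l) else 0 else 0)"
    by (intro sum.cong) auto
  then show ?thesis using finite_T assms by simp
qed

lemma selection_binary: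
  assumes "A \<subseteq> parts" "\<And>l. l \<in> parts \<Longrightarrow> a l \<in> T l"
  shows "selection a A \<in> binary_vectors n"
  using assms T_subset by (fastforce simp: selection_def binary_vectors_def vectors_def)

section \<open>Binary vectors, first stages and recourse\<close>

lemma binary_nonneg: "y \<in> binary_vectors n \<Longrightarrow> 0 \<le> y i"
  by (cases "i < n") (auto simp: binary_vectors_def vectors_def)

text \<open>The sum counts the ones in \<open>S\<close>, so it is a natural number.\<close>

lemma sum_binary_cases:
  assumes "y \<in> binary_vectors n" "finite S" "sum y S \<le> 1"
  shows "sum y S = 0 \<or> sum y S = 1"
proof -
  have "y i = of_bool (y i = 1)" for i
    using assms(1) by (cases "i < n") (auto simp: binary_vectors_def vectors_def)
  then have "sum y S = (\<Sum>i\<in>S. of_bool (y i = 1))" by (intro sum.cong) auto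
  also have "\<dots> = real (card {i\<in>S. y i = 1})"
    using assms(2) by (simp add: of_bool_def sum.If_cases Int_def)
  finally show ?thesis using assms(3) by (cases "card {i\<in>S. y i = 1}") auto
qed

text \<open>A recourse completes the sum over each part to \<open>1\<close> with nonnegative
  entries, so the sum of \<open>x\<close> is at most \<open>1\<close>, and it is integral.\<close>

lemma first_stage_sum:
  assumes "x \<in> first_stage I" "l \<in> parts"
  shows "(\<Sum>i\<in>T l. x i) = (if l \<in> open_parts I x then 0 else 1)"
proof -
  obtain y where y: "y \<in> recourse I x" and x: "x \<in> binary_vectors n"
    using assms by (auto simp: first_stage_def)
  then have "sum x (T l) + sum y (T l) = 1"
    using assms(2) by (auto simp: recourse_def feasible_def sum.distrib)
  moreover have "0 \<le> sum y (T l)"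
    using y by (intro sum_nonneg) (auto simp: recourse_def binary_nonneg)
  ultimately have "sum x (T l) = 0 \<or> sum x (T l) = 1"
    using sum_binary_cases[OF x finite_T[OF assms(2)]] by simp
  then show ?thesis using assms(2) by (auto simp: open_parts_def)
qed

lemma open_parts_subset: "open_parts I x \<subseteq> parts"
  by (auto simp: open_parts_def)

text \<open>The sums of \<open>x\<close> are assumed directly instead of
  \<open>x \<in> first_stage I\<close>, because the lemma also serves to prove that a constructed
  \<open>x\<close> is a first stage.\<close>

lemma selection_add_feasible:
  assumes x: "x \<in> binary_vectors n" and a: "\<And>l. l \<in> parts \<Longrightarrow> a l \<in> T l"
    and s: "\<And>l. l \<in> parts \<Longrightarrow> (\<Sum>i\<in>T l. x i) = (if l \<in> open_parts I x then 0 else 1)"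
  shows "selection a (open_parts I x) \<in> recourse I x"
proof -
  let ?y = "selection a (open_parts I x)"
  have y: "?y \<in> binary_vectors n" using a open_parts_subset by (intro selection_binary)
  have one: "(\<Sum>i\<in>T l. x i + ?y i) = 1" if "l \<in> parts" for l
    using sum_selection[OF that open_parts_subset a, where w = "\<lambda>_. 1"] s[OF that]
    by (simp add: sum.distrib)
  have "x i + ?y i \<in> {0, 1}" if "i < n" for i
  proof -
    obtain l where l: "l \<in> parts" "i \<in> T l" using Union_T \<open>i < n\<close> by blast
    \<comment> \<open>Excludes the entry \<open>2\<close>: nonnegative entries with sum
      \<open>1\<close> are at most \<open>1\<close>.\<close>
    have "x i + ?y i \<le> (\<Sum>i\<in>T l. x i + ?y i)"
      using l finite_T x y by (intro member_le_sum) (auto simp: binary_nonneg)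
    then have "x i + ?y i \<le> 1" using one[OF l(1)] by simp
    moreover have "x i = 0 \<or> x i = 1" "?y i = 0 \<or> ?y i = 1"
      using x y that by (auto simp: binary_vectors_def)
    ultimately show ?thesis by auto
  qed
  moreover have "(\<lambda>i. x i + ?y i) \<in> vectors n"
    using x y by (auto simp: binary_vectors_def vectors_def)
  ultimately show ?thesis
    using y one by (auto simp: recourse_def feasible_def binary_vectors_def)
qed

text \<open>Recourse decomposes by parts. In an open part the entries of \<open>y\<close> are
  nonnegative weights of sum \<open>1\<close>, whose cost is at least the minimum of
  \<open>w\<close>; selecting a cheapest tool in each open part attains all the minima at
  once.\<close>

lemma recourse_value_eq:
  assumes x: "x \<in> first_stage I"
  shows "recourse_value I x w = dot n C x + (\<Sum>l\<in>open_parts I x. Min (w ` T l))"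
proof -
  have "\<exists>i. i \<in> T l \<and> w i = Min (w ` T l)" if "l \<in> parts" for l
    using Min_in[of "w ` T l"] finite_T[OF that] T_nonempty[OF that] by fastforce
  then obtain a where a: "\<And>l. l \<in> parts \<Longrightarrow> a l \<in> T l" "\<And>l. l \<in> parts \<Longrightarrow> w (a l) = Min (w ` T l)"
    by metis
  let ?y = "selection a (open_parts I x)"
  have open_sum: "(\<Sum>l\<in>open_parts I x. f l) = (\<Sum>l\<in>parts. if l \<in> open_parts I x then f l else 0)"
    for f :: "nat \<Rightarrow> real"
    using open_parts_subset[of x] by (simp add: sum.If_cases Int_absorb1)
  have xb: "x \<in> binary_vectors n" using x by (auto simp: first_stage_def)
  have yr: "?y \<in> recourse I x"
    using selection_add_feasible[OF xb a(1) first_stage_sum[OF x]] by blast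
  have "dot n w ?y = (\<Sum>l\<in>open_parts I x. Min (w ` T l))"
    unfolding dot_parts open_sum
  proof (rule sum.cong[OF refl])
    fix l assume l: "l \<in> parts"
    show "(\<Sum>i\<in>T l. w i * ?y i) = (if l \<in> open_parts I x then Min (w ` T l) else 0)"
      using sum_selection[OF l open_parts_subset a(1), where w = w] a(2)[OF l] by simp
  qed
  moreover have "(\<Sum>l\<in>open_parts I x. Min (w ` T l)) \<le> dot n w y" if y: "y \<in> recourse I x" for y
    unfolding dot_parts open_sum
  proof (rule sum_mono)
    fix l assume l: "l \<in> parts"
    have yb: "y \<in> binary_vectors n" using y by (auto simp: recourse_def)
    have "sum x (T l) + sum y (T l) = 1"
      using y l by (auto simp: recourse_def feasible_def sum.distrib)
    then have s: "sum y (T l) = (if l \<in> open_parts I x then 1 else 0)"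
      using first_stage_sum[OF x l] by (auto split: if_splits)
    show "(if l \<in> open_parts I x then Min (w ` T l) else 0) \<le> (\<Sum>i\<in>T l. w i * y i)"
    proof (cases "l \<in> open_parts I x")
      case True
      have "Min (w ` T l) = (\<Sum>i\<in>T l. Min (w ` T l) * y i)"
        using s True by (simp flip: sum_distrib_left)
      also have "\<dots> \<le> (\<Sum>i\<in>T l. w i * y i)"
        using finite_T[OF l] binary_nonneg[OF yb] by (intro sum_mono mult_right_mono Min_le) auto
      finally show ?thesis using True by simp
    next
      case False
      then have "\<forall>i\<in>T l. y i = 0"
        using s finite_T[OF l] binary_nonneg[OF yb] sum_nonneg_eq_0_iff[of "T l" y] by auto
      then show ?thesis using False by simp
    qed
  qed
  ultimately show ?thesis
    unfolding recourse_value_def total_cost_def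
    using finite_recourse[of I x] yr by (intro Min_eqI) force+
qed

text \<open>Weak duality summed over the open parts: together they spend at most the budget,
  whatever \<open>k\<close> is.\<close>

lemma robust_value_le:
  assumes x: "x \<in> first_stage I"
  shows "robust_value I x \<le>
    dot n C x + (budget I / real k + (\<Sum>l\<in>open_parts I x. gain l k))"
  unfolding robust_value_def
proof (rule cSUP_least)
  show "uncertainty I \<noteq> {}" using nominal_in_uncertainty[OF valid] by blast
  fix w assume "w \<in> uncertainty I"
  then obtain \<delta> where \<delta>: "\<And>i. i < n \<Longrightarrow> 0 \<le> \<delta> i \<and> \<delta> i \<le> d i" "l1_norm n \<delta> \<le> budget I"
      "w = (\<lambda>i. c i + \<delta> i)"
    by (auto simp: uncertainty_def)
  have nn: "0 \<le> sum \<delta> (T l)" if "l \<in> parts" for l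
    using T_subset[OF that] \<delta>(1) by (intro sum_nonneg) auto
  have "(\<Sum>l\<in>open_parts I x. sum \<delta> (T l)) \<le> (\<Sum>l\<in>parts. sum \<delta> (T l))"
    using open_parts_subset nn by (intro sum_mono2) auto
  also have "\<dots> = l1_norm n \<delta>"
    using \<delta>(1) by (simp add: l1_norm_def flip: sum_parts)
  finally have "(\<Sum>l\<in>open_parts I x. sum \<delta> (T l)) / real k \<le> budget I / real k"
    using \<delta>(2) by (intro divide_right_mono) auto
  moreover have "(\<Sum>l\<in>open_parts I x. Min (w ` T l)) \<le>
      (\<Sum>l\<in>open_parts I x. gain l k + sum \<delta> (T l) / real k)"
  proof (rule sum_mono)
    fix l assume "l \<in> open_parts I x"
    then have l: "l \<in> parts" using open_parts_subset by blast
    show "Min (w ` T l) \<le> gain l k + sum \<delta> (T l) / real k"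
      unfolding \<delta>(3) using \<delta>(1) T_subset[OF l] by (intro part.weak_duality[OF part_T[OF l]]) auto
  qed
  ultimately show "recourse_value I x w \<le>
      dot n C x + (budget I / real k + (\<Sum>l\<in>open_parts I x. gain l k))"
    unfolding recourse_value_eq[OF x] by (simp add: sum.distrib flip: sum_divide_distrib)
qed

text \<open>Strong duality on the open parts yields deviations that vanish elsewhere and hence form
  a scenario of the uncertainty set. The index \<open>k\<close> depends on \<open>x\<close>.\<close>

lemma robust_value_ge:
  assumes x: "x \<in> first_stage I"
  shows "\<exists>k\<le>n. dot n C x + (budget I / real k + (\<Sum>l\<in>open_parts I x. gain l k)) \<le> robust_value I x"
proof -
  let ?U = "\<Union>l\<in>open_parts I x. T l"
  have sub: "l \<in> parts" if "l \<in> open_parts I x" for l using that open_parts_subset by blast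
  have "finite (open_parts I x)" by (simp add: open_parts_def)
  moreover have "disjoint_family_on T (open_parts I x)"
    using disjoint_T sub by (auto simp: disjoint_family_on_def)
  ultimately obtain k \<delta> where k: "k \<le> n" and \<delta>: "\<And>i. 0 \<le> \<delta> i" "\<And>i. i \<notin> ?U \<Longrightarrow> \<delta> i = 0"
      "\<And>l i. l \<in> open_parts I x \<Longrightarrow> i \<in> T l \<Longrightarrow> \<delta> i \<le> d i" "sum \<delta> ?U \<le> budget I"
    and le: "budget I / real k + (\<Sum>l\<in>open_parts I x. gain l k) \<le>
      (\<Sum>l\<in>open_parts I x. Min ((\<lambda>i. c i + \<delta> i) ` T l))"
    using strong_duality[of "open_parts I x" T d n "budget I" c] sub part_T card_T_le budget_nonneg
    by blast
  have U: "?U \<subseteq> {..<n}" using T_subset sub by blast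
  have "\<delta> i = 0" if "n \<le> i" for i using that U \<delta>(2) by (meson lessThan_iff not_le subsetD)
  moreover have "\<delta> i \<le> d i" if "i < n" for i
  proof (cases "i \<in> ?U")
    case False
    then show ?thesis
      using \<delta>(2)[of i] valid that by (auto simp: valid_instance_def nonneg_vectors_def)
  qed (use \<delta>(3) in auto)
  moreover have "l1_norm n \<delta> \<le> budget I"
  proof -
    have "l1_norm n \<delta> = sum \<delta> ?U"
      unfolding l1_norm_def using U \<delta> by (intro sum.mono_neutral_cong_right) auto
    then show ?thesis using \<delta>(4) by simp
  qed
  ultimately have w: "(\<lambda>i. c i + \<delta> i) \<in> uncertainty I"
    using \<delta>(1) by (auto simp: uncertainty_def vectors_def)
  \<comment> \<open>A real supremum bounds its members only if they are bounded above; attainment of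
    the maximum provides this.\<close>
  have "bdd_above (recourse_value I x ` uncertainty I)"
    using robust_value_attained[OF valid x] by (auto intro: bdd_aboveI2)
  then have "recourse_value I x (\<lambda>i. c i + \<delta> i) \<le> robust_value I x"
    unfolding robust_value_def using w by (intro cSUP_upper)
  then show ?thesis using k le unfolding recourse_value_eq[OF x] by (intro exI[of _ k]) auto
qed

section \<open>Minimisation over the first stages\<close>

lemma Min_first_cost_le:
  assumes x: "x \<in> first_stage I" and l: "l \<in> parts" "l \<notin> open_parts I x"
  shows "Min (C ` T l) \<le> (\<Sum>i\<in>T l. C i * x i)"
proof -
  have xb: "x \<in> binary_vectors n" using x by (auto simp: first_stage_def)
  have "Min (C ` T l) = (\<Sum>i\<in>T l. Min (C ` T l) * x i)"
    using first_stage_sum[OF x l(1)] l(2) by (simp flip: sum_distrib_left)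
  also have "\<dots> \<le> (\<Sum>i\<in>T l. C i * x i)"
    using finite_T[OF l(1)] binary_nonneg[OF xb] by (intro sum_mono mult_right_mono Min_le) auto
  finally show ?thesis .
qed

text \<open>Comparison part by part: a part bought by \<open>x\<close> costs at least its smallest
  first-stage cost, and an open part at least its gain, as first-stage costs are
  nonnegative.\<close>

lemma dual_value_le_robust_value:
  assumes x: "x \<in> first_stage I"
  shows "\<exists>k\<le>n. dual_value I k \<le> robust_value I x"
proof -
  obtain k where k: "k \<le> n"
    "dot n C x + (budget I / real k + (\<Sum>l\<in>open_parts I x. gain l k)) \<le> robust_value I x"
    using robust_value_ge[OF x] by blast
  have xb: "x \<in> binary_vectors n" using x by (auto simp: first_stage_def)
  have open_sum: "(\<Sum>l\<in>open_parts I x. gain l k) = (\<Sum>l\<in>parts. if l \<in> open_parts I x then gain l k else 0)"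
    using open_parts_subset[of x] by (simp add: sum.If_cases Int_absorb1)
  have "(\<Sum>l\<in>parts. min (Min (C ` T l)) (gain l k)) \<le>
      dot n C x + (\<Sum>l\<in>open_parts I x. gain l k)"
    unfolding dot_parts open_sum sum.distrib[symmetric]
  proof (rule sum_mono)
    fix l assume l: "l \<in> parts"
    have "0 \<le> (\<Sum>i\<in>T l. C i * x i)"
      using valid T_subset[OF l] binary_nonneg[OF xb]
      by (intro sum_nonneg mult_nonneg_nonneg) (auto simp: valid_instance_def nonneg_vectors_def)
    then show "min (Min (C ` T l)) (gain l k) \<le>
        (\<Sum>i\<in>T l. C i * x i) + (if l \<in> open_parts I x then gain l k else 0)"
      using Min_first_cost_le[OF x l] by auto
  qed
  then show ?thesis using k by (intro exI[of _ k]) (auto simp: dual_value_def)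
qed

text \<open>Weak duality at \<open>k\<close> bounds the value of \<open>x\<close> from above by
  \<open>dual_value I k\<close>. By strong duality every first stage has value at least some
  \<open>dual_value I j\<close> with \<open>j \<le> n\<close>, hence at least the smallest, so the
  bounds meet.\<close>

lemma optimal_selection:
  assumes k: "k \<le> n" "\<And>j. j \<le> n \<Longrightarrow> dual_value I k \<le> dual_value I j"
    and a: "\<And>l. l \<in> parts \<Longrightarrow> a l \<in> T l" "\<And>l. l \<in> parts \<Longrightarrow> C (a l) = Min (C ` T l)"
  defines "x \<equiv> selection a {l\<in>parts. Min (C ` T l) < gain l k}"
  shows "x \<in> first_stage I" "robust_value I x = optimal_value I" "optimal_value I = dual_value I k"
proof -
  let ?A = "{l\<in>parts. Min (C ` T l) < gain l k}"
  have sub: "?A \<subseteq> parts" by blast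
  have sx: "(\<Sum>i\<in>T l. w i * x i) = (if l \<in> ?A then w (a l) else 0)" if "l \<in> parts" for l w
    unfolding x_def by (rule sum_selection[OF that sub a(1)])
  have op: "open_parts I x = parts - ?A"
    using sx[of _ "\<lambda>_. 1"] by (auto simp: open_parts_def split: if_splits)
  have xb: "x \<in> binary_vectors n" unfolding x_def by (rule selection_binary[OF sub a(1)])
  have s: "(\<Sum>i\<in>T l. x i) = (if l \<in> open_parts I x then 0 else 1)" if "l \<in> parts" for l
    using sx[OF that, of "\<lambda>_. 1"] op that by auto
  have "selection a (open_parts I x) \<in> recourse I x"
    using xb a(1) s by (rule selection_add_feasible)
  then show x: "x \<in> first_stage I" using xb by (auto simp: first_stage_def)
  have "dot n C x + (\<Sum>l\<in>open_parts I x. gain l k) = (\<Sum>l\<in>parts. min (Min (C ` T l)) (gain l k))"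
  proof -
    have "(\<Sum>l\<in>open_parts I x. gain l k) = (\<Sum>l\<in>parts. if l \<in> open_parts I x then gain l k else 0)"
      using open_parts_subset[of x] by (simp add: sum.If_cases Int_absorb1)
    then show ?thesis
      unfolding dot_parts using sx a(2) op
      by (auto simp flip: sum.distrib intro!: sum.cong)
  qed
  then have "robust_value I x \<le> dual_value I k"
    using robust_value_le[OF x, of k] by (simp add: dual_value_def)
  moreover have ge: "dual_value I k \<le> robust_value I z" if "z \<in> first_stage I" for z
    using dual_value_le_robust_value[OF that] k(2) order_trans by blast
  ultimately have eq: "robust_value I x = dual_value I k" using x by (simp add: antisym)
  then show opt: "optimal_value I = dual_value I k"
    unfolding optimal_value_def using x ge finite_first_stage[of I]
    by (intro Min_eqI) (auto intro: image_eqI[OF _ x])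
  show "robust_value I x = optimal_value I" using eq opt by simp
qed

end

section \<open>Timed program logic\<close>

primrec iwrites :: "com \<Rightarrow> bank set" where
  "iwrites Skip = {}"
| "iwrites (IAssign a e f) = {a}"
| "iwrites (RAssign a e f) = {}"
| "iwrites (Seq p q) = iwrites p \<union> iwrites q"
| "iwrites (Cond b p q) = iwrites p \<union> iwrites q"
| "iwrites (While b p) = iwrites p"

primrec rwrites :: "com \<Rightarrow> bank set" where
  "rwrites Skip = {}"
| "rwrites (IAssign a e f) = {}"
| "rwrites (RAssign a e f) = {a}"
| "rwrites (Seq p q) = rwrites p \<union> rwrites q"
| "rwrites (Cond b p q) = rwrites p \<union> rwrites q"
| "rwrites (While b p) = rwrites p"

lemma mem_write [simp]:
  "imem (iwrite a j v s) = (imem s)(a := (imem s a)(j := v))"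
  "rmem (iwrite a j v s) = rmem s"
  "rmem (rwrite a j w s) = (rmem s)(a := (rmem s a)(j := w))"
  "imem (rwrite a j w s) = imem s"
  by (simp_all add: iwrite_def rwrite_def)

text \<open>Whole banks are preserved, so distinct bank names replace reasoning about individual
  cells.\<close>

definition frame :: "com \<Rightarrow> memory \<Rightarrow> memory \<Rightarrow> bool" where
  "frame p s s' \<longleftrightarrow> (\<forall>a. a \<notin> iwrites p \<longrightarrow> imem s' a = imem s a) \<and>
                   (\<forall>a. a \<notin> rwrites p \<longrightarrow> rmem s' a = rmem s a)"

lemma frame_imem: "frame p s s' \<Longrightarrow> a \<notin> iwrites p \<Longrightarrow> imem s' a = imem s a"
  and frame_rmem: "frame p s s' \<Longrightarrow> a \<notin> rwrites p \<Longrightarrow> rmem s' a = rmem s a"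
  by (auto simp: frame_def)

lemma run_frame: "run p s t s' \<Longrightarrow> frame p s s'"
  by (induction rule: run.induct) (auto simp: frame_def)

text \<open>\<open>wp\<close> is a weakest precondition for total correctness within a time budget.\<close>

definition wp :: "com \<Rightarrow> nat \<Rightarrow> (memory \<Rightarrow> bool) \<Rightarrow> memory \<Rightarrow> bool" where
  "wp p b Q s \<longleftrightarrow> (\<exists>t s'. run p s t s' \<and> t \<le> b \<and> Q s')"

lemma wp_mono:
  assumes "wp p b Q s" "b \<le> b'" "\<And>s'. frame p s s' \<Longrightarrow> Q s' \<Longrightarrow> Q' s'"
  shows "wp p b' Q' s"
proof -
  obtain t s' where p: "run p s t s'" "t \<le> b" "Q s'"
    using assms(1) by (auto simp: wp_def)
  show ?thesis
    unfolding wp_def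
    using p assms(2) assms(3)[OF run_frame[OF p(1)] p(3)] by (blast intro: le_trans)
qed

lemma wp_Seq:
  assumes "wp p b R s" "\<And>s'. frame p s s' \<Longrightarrow> R s' \<Longrightarrow> wp q b' Q s'"
  shows "wp (Seq p q) (b + b') Q s"
proof -
  obtain t s' where p: "run p s t s'" "t \<le> b" "R s'"
    using assms(1) by (auto simp: wp_def)
  obtain t' s'' where q: "run q s' t' s''" "t' \<le> b'" "Q s''"
    using assms(2)[OF run_frame[OF p(1)] p(3)] by (auto simp: wp_def)
  show ?thesis
    unfolding wp_def using run.Seq[OF p(1) q(1)] add_mono[OF p(2) q(2)] q(3) by blast
qed

lemma wp_Cond:
  assumes "bval b s \<Longrightarrow> wp p k Q s" "\<not> bval b s \<Longrightarrow> wp q k Q s"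
  shows "wp (Cond b p q) (bcost b + 1 + k) Q s"
proof (cases "bval b s")
  case True
  then obtain t s' where "run p s t s'" "t \<le> k" "Q s'"
    using assms(1) by (auto simp: wp_def)
  then show ?thesis
    unfolding wp_def using run.CondTrue[OF True, of p t s' q]
    by (intro exI[of _ "bcost b + 1 + t"] exI[of _ s']) simp
next
  case False
  then obtain t s' where "run q s t s'" "t \<le> k" "Q s'"
    using assms(2) by (auto simp: wp_def)
  then show ?thesis
    unfolding wp_def using run.CondFalse[OF False, of q t s' p]
    by (intro exI[of _ "bcost b + 1 + t"] exI[of _ s']) simp
qed

section \<open>Symbolic execution of loop-free code\<close>

primrec loop_free :: "com \<Rightarrow> bool" where
  "loop_free Skip \<longleftrightarrow> True"
| "loop_free (IAssign a e f) \<longleftrightarrow> True"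
| "loop_free (RAssign a e f) \<longleftrightarrow> True"
| "loop_free (Seq p q) \<longleftrightarrow> loop_free p \<and> loop_free q"
| "loop_free (Cond b p q) \<longleftrightarrow> loop_free p \<and> loop_free q"
| "loop_free (While b p) \<longleftrightarrow> False"

text \<open>Lets the simplifier compute the effect of loop-free code without unfolding
  \<open>run\<close>. \<open>While\<close> gets a default value, and \<open>run_loop_free\<close> is
  restricted to programs without it.\<close>

primrec exec :: "com \<Rightarrow> memory \<Rightarrow> memory" where
  "exec Skip s = s"
| "exec (IAssign a e f) s = iwrite a (ival e s) (ival f s) s"
| "exec (RAssign a e f) s = rwrite a (ival e s) (rval f s) s"
| "exec (Seq p q) s = exec q (exec p s)"
| "exec (Cond b p q) s = (if bval b s then exec p s else exec q s)"
| "exec (While b p) s = s"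

primrec max_cost :: "com \<Rightarrow> nat" where
  "max_cost Skip = 1"
| "max_cost (IAssign a e f) = icost e + icost f + 1"
| "max_cost (RAssign a e f) = icost e + rcost f + 1"
| "max_cost (Seq p q) = max_cost p + max_cost q"
| "max_cost (Cond b p q) = bcost b + 1 + max (max_cost p) (max_cost q)"
| "max_cost (While b p) = 0"

lemma run_loop_free: "loop_free p \<Longrightarrow> \<exists>t\<le>max_cost p. run p s t (exec p s)"
proof (induction p arbitrary: s)
  case (Seq p q)
  then obtain t t' where "t \<le> max_cost p" "run p s t (exec p s)"
      "t' \<le> max_cost q" "run q (exec p s) t' (exec q (exec p s))"
    by (metis loop_free.simps(4))
  then show ?case
    by (intro exI[of _ "t + t'"]) (auto intro: run.Seq)
next
  case (Cond b p q)
  show ?case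
  proof (cases "bval b s")
    case True
    then obtain t where "t \<le> max_cost p" "run p s t (exec p s)"
      using Cond by auto
    then show ?thesis
      using True run.CondTrue[OF True, of p t _ q] by (intro exI[of _ "bcost b + 1 + t"]) auto
  next
    case False
    then obtain t where "t \<le> max_cost q" "run q s t (exec q s)"
      using Cond by auto
    then show ?thesis
      using False run.CondFalse[OF False, of q t _ p] by (intro exI[of _ "bcost b + 1 + t"]) auto
  qed
next
  case Skip
  then show ?case using run.Skip by auto
next
  case (IAssign a e f)
  then show ?case using run.IAssign by auto
next
  case (RAssign a e f)
  then show ?case using run.RAssign by auto
qed simp

lemma wp_loop_free:
  assumes "loop_free p" "max_cost p \<le> b" "Q (exec p s)"
  shows "wp p b Q s"
  using run_loop_free[OF assms(1), of s] assms(2,3) unfolding wp_def by (blast intro: le_trans)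

text \<open>The bound is a memory cell that every test reads again; this is why
  \<open>wp_For\<close> demands that the body leave \<open>N\<close> and \<open>v\<close>
  alone.\<close>

definition For :: "bank \<Rightarrow> bank \<Rightarrow> com \<Rightarrow> com" where
  "For v N p = Seq (IAssign v (INum 0) (INum 0))
     (While (ILess (ICell v (INum 0)) (ICell N (INum 0)))
        (Seq p (IAssign v (INum 0) (IAdd (ICell v (INum 0)) (INum 1)))))"

lemma writes_For [simp]:
  "iwrites (For v N p) = insert v (iwrites p)"
  "rwrites (For v N p) = rwrites p"
  by (auto simp: For_def)

text \<open>Besides \<open>b\<close>, an iteration costs 6 units for the test and 6 for the
  increment; the 9 are the initialisation and the final test. \<open>m'\<close> may exceed the
  iteration count \<open>m\<close>, so that loops over parts can be charged in terms of
  \<open>n\<close>.\<close>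

lemma wp_For:
  assumes v: "v \<notin> iwrites p" "N \<notin> iwrites p" "N \<noteq> v"
    and m: "imem s\<^sub>0 N 0 = m" "m \<le> m'"
    and init: "Inv 0 (iwrite v 0 0 s\<^sub>0)"
    and step: "\<And>i s. i < m \<Longrightarrow> frame (For v N p) s\<^sub>0 s \<Longrightarrow> imem s v 0 = i \<Longrightarrow> Inv i s \<Longrightarrow>
       wp p b (\<lambda>s'. Inv (Suc i) (iwrite v 0 (Suc i) s')) s"
    and post: "\<And>s. frame (For v N p) s\<^sub>0 s \<Longrightarrow> Inv m s \<Longrightarrow> Q s"
  shows "wp (For v N p) (9 + m' * (b + 12)) Q s\<^sub>0"
proof -
  let ?b = "ILess (ICell v (INum 0)) (ICell N (INum 0))"
  let ?q = "Seq p (IAssign v (INum 0) (IAdd (ICell v (INum 0)) (INum 1)))"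
  \<comment> \<open>Induction on the number \<open>k\<close> of iterations that remain.\<close>
  have loop: "\<exists>t s'. run (While ?b ?q) s t s' \<and> t \<le> 6 + k * (b + 12) \<and> Inv m s'"
    if "k + i = m" "frame (For v N p) s\<^sub>0 s" "imem s v 0 = i" "Inv i s" for k i s
    using that
  proof (induction k arbitrary: i s)
    case 0
    then have "imem s N 0 = m"
      using v m frame_imem[OF 0(2), of N] by simp
    then have "run (While ?b ?q) s (bcost ?b + 1) s"
      using 0 by (intro run.WhileFalse) auto
    then show ?case using 0 by (intro exI[of _ "bcost ?b + 1"] exI[of _ s]) auto
  next
    case (Suc k)
    have N: "imem s N 0 = m"
      using v m frame_imem[OF Suc(3), of N] by simp
    obtain t s' where p: "run p s t s'" "t \<le> b" "Inv (Suc i) (iwrite v 0 (Suc i) s')"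
      using step[OF _ Suc(3,4,5)] Suc(2) by (auto simp: wp_def)
    have v': "imem s' v 0 = i"
      using frame_imem[OF run_frame[OF p(1)] v(1)] Suc(4) by simp
    have q: "run ?q s (t + 6) (iwrite v 0 (Suc i) s')"
      using run.Seq[OF p(1) run.IAssign[of v "INum 0" "IAdd (ICell v (INum 0)) (INum 1)" s']] v'
      by (simp add: numeral_eq_Suc)
    have "frame (For v N p) s\<^sub>0 (iwrite v 0 (Suc i) s')"
      using Suc(3) run_frame[OF p(1)] by (auto simp: frame_def)
    then obtain t' s'' where w: "run (While ?b ?q) (iwrite v 0 (Suc i) s') t' s''"
        "t' \<le> 6 + k * (b + 12)" "Inv m s''"
      using Suc.IH[of "Suc i" "iwrite v 0 (Suc i) s'"] Suc(2) p(3) by auto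
    have "run (While ?b ?q) s (bcost ?b + 1 + (t + 6) + t') s''"
      using Suc(2,4) N by (intro run.WhileTrue[OF _ q w(1)]) auto
    moreover have "bcost ?b + 1 + (t + 6) + t' \<le> 6 + Suc k * (b + 12)"
      using p(2) w(2) by simp
    ultimately show ?case using w(3) by blast
  qed
  have "frame (For v N p) s\<^sub>0 (iwrite v 0 0 s\<^sub>0)"
    by (auto simp: frame_def)
  from loop[OF _ this _ init] obtain t s' where
    w: "run (While ?b ?q) (iwrite v 0 0 s\<^sub>0) t s'" "t \<le> 6 + m * (b + 12)" "Inv m s'"
    by auto
  have r: "run (For v N p) s\<^sub>0 (3 + t) s'"
    unfolding For_def using run.Seq[OF run.IAssign[of v "INum 0" "INum 0" s\<^sub>0], of _ t s'] w(1)
    by (simp add: numeral_eq_Suc)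
  have "m * (b + 12) \<le> m' * (b + 12)" using m(2) by (rule mult_right_mono) simp
  then have "3 + t \<le> 9 + m' * (b + 12)" using w(2) by linarith
  then show ?thesis
    unfolding wp_def using r post[OF run_frame[OF r] w(3)] by blast
qed

section \<open>The algorithm\<close>

abbreviation (input) IVar :: "bank \<Rightarrow> iexp" where "IVar v \<equiv> ICell v (INum 0)"
abbreviation (input) RVar :: "bank \<Rightarrow> rexp" where "RVar v \<equiv> RCell v (INum 0)"
abbreviation (input) "this_part \<equiv> ICell ''part'' (IVar ''i'')"

text \<open>The first pass stores the value of some tool in the cell of each part, as a starting
  value in place of infinity; the second pass lowers it to the minimum.\<close>

definition part_min :: "bank \<Rightarrow> rexp \<Rightarrow> com" where
  "part_min A e =
    Seq (For ''i'' ''n'' (RAssign A this_part e))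
        (For ''i'' ''n'' (Cond (RLess e (RCell A this_part)) (RAssign A this_part e) Skip))"

text \<open>Two negated \<open>ILess\<close> tests express that \<open>i\<close> and
  \<open>j\<close> lie in the same part, as the machine has no equality test. The test against
  \<open>e\<close> realises the maximum with \<open>0\<close>.\<close>

definition part_raise_cost :: "bank \<Rightarrow> rexp \<Rightarrow> com" where
  "part_raise_cost A e =
    For ''i'' ''n'' (Seq (RAssign A (IVar ''i'') (RNum 0))
      (For ''j'' ''n'' (Cond
        (BAnd (BAnd (BNot (ILess this_part (ICell ''part'' (IVar ''j''))))
                    (BNot (ILess (ICell ''part'' (IVar ''j'')) this_part)))
              (RLess (RCell ''c'' (IVar ''j'')) e))
        (RAssign A (IVar ''i'') (RAdd (RCell A (IVar ''i'')) (RSub e (RCell ''c'' (IVar ''j''))))) Skip)))"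

definition representatives :: com where
  "representatives =
    For ''i'' ''n'' (Cond (RLess (RCell ''M'' this_part) (RCell ''C'' (IVar ''i'')))
      Skip (IAssign ''a'' this_part (IVar ''i'')))"

lemma frame_trans:
  assumes "frame p s s'" "frame q s' s''"
    "iwrites p \<union> iwrites q \<subseteq> iwrites r" "rwrites p \<union> rwrites q \<subseteq> rwrites r"
  shows "frame r s s''"
  using assms unfolding frame_def by (metis UnCI subsetD)

lemma frame_mono:
  "frame p s s' \<Longrightarrow> iwrites p \<subseteq> iwrites r \<Longrightarrow> rwrites p \<subseteq> rwrites r \<Longrightarrow> frame r s s'"
  unfolding frame_def by (metis subsetD)

lemma encodes_frame:
  assumes "encodes s I" "frame p s s'"
    "{''n'', ''l'', ''part''} \<inter> iwrites p = {}" "{''C'', ''c'', ''d'', ''Gamma''} \<inter> rwrites p = {}"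
  shows "encodes s' I"
  using assms by (auto simp: encodes_def frame_def)

section \<open>Correctness and running time of the building blocks\<close>

context rs_instance
begin

lemma part_of: "encodes s I \<Longrightarrow> l \<in> parts \<Longrightarrow> i \<in> T l \<Longrightarrow> imem s ''part'' i = l"
  by (auto simp: encodes_def)

lemma num_tools_of: "encodes s I \<Longrightarrow> imem s ''n'' 0 = n"
  by (auto simp: encodes_def)

lemma part_exists: "i < n \<Longrightarrow> \<exists>l\<in>parts. i \<in> T l"
  using Union_T by blast

lemma T_less: "l \<in> parts \<Longrightarrow> i \<in> T l \<Longrightarrow> i < n"
  using T_subset by blast

lemma T_inhabited: "l \<in> parts \<Longrightarrow> \<exists>i. i \<in> T l"
  using T_nonempty by blast

lemma T_other: "l \<in> parts \<Longrightarrow> i \<in> T l \<Longrightarrow> l' \<in> parts \<Longrightarrow> l' \<noteq> l \<Longrightarrow> i \<notin> T l'"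
  using T_unique by blast

lemma wp_part_min:
  assumes enc: "encodes s\<^sub>0 I" and A: "A \<notin> {''C'', ''c'', ''d'', ''Gamma''}"
    and e: "\<And>s i. i < n \<Longrightarrow> frame (part_min A e) s\<^sub>0 s \<Longrightarrow> imem s ''i'' 0 = i \<Longrightarrow> rval e s = v i"
    and K: "rcost e \<le> K"
    and post: "\<And>s. frame (part_min A e) s\<^sub>0 s \<Longrightarrow> (\<And>l. l \<in> parts \<Longrightarrow> rmem s A l = Min (v ` T l)) \<Longrightarrow> Q s"
  shows "wp (part_min A e) ((9 + n * ((K + 4) + 12)) + (9 + n * ((2 * K + 10) + 12))) Q s\<^sub>0"
proof -
  \<comment> \<open>The first pass establishes \<open>?R\<close>, which the second keeps while
    adding the lower bounds in \<open>?I2\<close>; a value that is attained and is a lower bound is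
    the minimum.\<close>
  let ?I1 = "\<lambda>i (s :: memory). \<forall>l\<in>parts. (\<exists>j\<in>T l. j < i) \<longrightarrow> (\<exists>j\<in>T l. rmem s A l = v j)"
  let ?R = "\<lambda>s :: memory. \<forall>l\<in>parts. \<exists>j\<in>T l. rmem s A l = v j"
  let ?I2 = "\<lambda>i (s :: memory). ?R s \<and> (\<forall>l\<in>parts. \<forall>j\<in>T l. j < i \<longrightarrow> rmem s A l \<le> v j)"
  have enc': "encodes s I" if "frame (part_min A e) s\<^sub>0 s" for s
    using that A by (intro encodes_frame[OF enc]) (auto simp: part_min_def)
  show ?thesis
    unfolding part_min_def
  proof (rule wp_Seq)
    show "wp (For ''i'' ''n'' (RAssign A this_part e)) (9 + n * ((K + 4) + 12)) ?R s\<^sub>0"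
    proof (rule wp_For[where Inv = ?I1 and m = n])
      fix i s assume i: "i < n" and fr: "frame (For ''i'' ''n'' (RAssign A this_part e)) s\<^sub>0 s"
        and ci: "imem s ''i'' 0 = i" and inv: "?I1 i s"
      have fr': "frame (part_min A e) s\<^sub>0 s"
        using fr by (rule frame_mono) (auto simp: part_min_def)
      obtain l where l: "l \<in> parts" "i \<in> T l" using part_exists[OF i] by blast
      have pt: "imem s ''part'' i = l" using part_of[OF enc'[OF fr'] l] .
      have ev: "rval e s = v i" using e[OF i fr' ci] .
      show "wp (RAssign A this_part e) (K + 4) (\<lambda>s'. ?I1 (Suc i) (iwrite ''i'' 0 (Suc i) s')) s"
      proof (rule wp_loop_free)
        show "?I1 (Suc i) (iwrite ''i'' 0 (Suc i) (exec (RAssign A this_part e) s))"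
          using inv l T_other[OF l] by (auto simp: ci pt ev less_Suc_eq)
      qed (use K in auto)
    qed (use num_tools_of[OF enc] T_less T_inhabited in auto)
  next
    fix s\<^sub>1 assume fr1: "frame (For ''i'' ''n'' (RAssign A this_part e)) s\<^sub>0 s\<^sub>1" and R: "?R s\<^sub>1"
    let ?p = "Cond (RLess e (RCell A this_part)) (RAssign A this_part e) Skip"
    have fr1': "frame (part_min A e) s\<^sub>0 s" if "frame (For ''i'' ''n'' ?p) s\<^sub>1 s" for s
      by (rule frame_trans[OF fr1 that]) (auto simp: part_min_def)
    have enc1: "encodes s\<^sub>1 I"
      using fr1 by (intro enc' frame_mono[OF fr1]) (auto simp: part_min_def)
    show "wp (For ''i'' ''n'' ?p) (9 + n * ((2 * K + 10) + 12)) Q s\<^sub>1"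
    proof (rule wp_For[where Inv = ?I2 and m = n])
      fix i s assume i: "i < n" and fr: "frame (For ''i'' ''n'' ?p) s\<^sub>1 s"
        and ci: "imem s ''i'' 0 = i" and inv: "?I2 i s"
      obtain l where l: "l \<in> parts" "i \<in> T l" using part_exists[OF i] by blast
      have pt: "imem s ''part'' i = l" using part_of[OF enc'[OF fr1'[OF fr]] l] .
      have ev: "rval e s = v i" using e[OF i fr1'[OF fr] ci] .
      show "wp ?p (2 * K + 10) (\<lambda>s'. ?I2 (Suc i) (iwrite ''i'' 0 (Suc i) s')) s"
      proof (rule wp_loop_free)
        show "?I2 (Suc i) (iwrite ''i'' 0 (Suc i) (exec ?p s))"
        proof (cases "v i < rmem s A l")
          case True
          then show ?thesis
            using inv l T_other[OF l] by (fastforce simp: ci pt ev less_Suc_eq)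
        next
          case False
          then show ?thesis
            using inv l T_other[OF l] by (fastforce simp: ci pt ev less_Suc_eq)
        qed
      qed (use K in auto)
    next
      fix s assume fr: "frame (For ''i'' ''n'' ?p) s\<^sub>1 s" and inv: "?I2 n s"
      show "Q s"
      proof (rule post[OF fr1'[OF fr]])
        fix l assume l: "l \<in> parts"
        then show "rmem s A l = Min (v ` T l)"
          using inv finite_T[OF l] T_less[OF l] by (intro Min_eqI[symmetric]) auto
      qed
    qed (use num_tools_of[OF enc1] R in auto)
  qed
qed

lemma wp_part_raise_cost:
  assumes enc: "encodes s\<^sub>0 I" and A: "A \<notin> {''C'', ''c'', ''d'', ''Gamma''}"
    and e: "\<And>s i. i < n \<Longrightarrow> frame (part_raise_cost A e) s\<^sub>0 s \<Longrightarrow> imem s ''i'' 0 = i \<Longrightarrow> rval e s = v i"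
    and K: "rcost e \<le> K"
    and post: "\<And>s. frame (part_raise_cost A e) s\<^sub>0 s \<Longrightarrow>
      (\<And>l i. l \<in> parts \<Longrightarrow> i \<in> T l \<Longrightarrow> rmem s A i = raise_cost (T l) c (v i)) \<Longrightarrow> Q s"
  shows "wp (part_raise_cost A e) (9 + n * ((4 + (9 + n * ((2 * K + 38) + 12))) + 12)) Q s\<^sub>0"
proof -
  let ?Inv = "\<lambda>i (s :: memory). \<forall>l\<in>parts. \<forall>j\<in>T l. j < i \<longrightarrow> rmem s A j = raise_cost (T l) c (v j)"
  let ?p = "Cond
        (BAnd (BAnd (BNot (ILess this_part (ICell ''part'' (IVar ''j''))))
                    (BNot (ILess (ICell ''part'' (IVar ''j'')) this_part)))
              (RLess (RCell ''c'' (IVar ''j'')) e))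
        (RAssign A (IVar ''i'') (RAdd (RCell A (IVar ''i'')) (RSub e (RCell ''c'' (IVar ''j''))))) Skip"
  let ?q = "Seq (RAssign A (IVar ''i'') (RNum 0)) (For ''j'' ''n'' ?p)"
  have enc': "encodes s I" if "frame (part_raise_cost A e) s\<^sub>0 s" for s
    using that A by (intro encodes_frame[OF enc]) (auto simp: part_raise_cost_def)
  show ?thesis
    unfolding part_raise_cost_def
  proof (rule wp_For[where Inv = ?Inv and m = n])
    fix i s assume i: "i < n" and fr: "frame (For ''i'' ''n'' ?q) s\<^sub>0 s"
      and ci: "imem s ''i'' 0 = i" and inv: "?Inv i s"
    obtain l where l: "l \<in> parts" "i \<in> T l" using part_exists[OF i] by blast
    let ?R = "\<lambda>s :: memory. ?Inv i s \<and> rmem s A i = 0"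
    show "wp ?q (4 + (9 + n * ((2 * K + 38) + 12))) (\<lambda>s'. ?Inv (Suc i) (iwrite ''i'' 0 (Suc i) s')) s"
    proof (rule wp_Seq[where R = ?R])
      show "wp (RAssign A (IVar ''i'') (RNum 0)) 4 ?R s"
        using inv by (intro wp_loop_free) (auto simp: ci)
    next
      fix s\<^sub>1 assume fr1: "frame (RAssign A (IVar ''i'') (RNum 0)) s s\<^sub>1" and R: "?R s\<^sub>1"
      have fr': "frame (part_raise_cost A e) s\<^sub>0 s'" if "frame (For ''j'' ''n'' ?p) s\<^sub>1 s'" for s'
      proof (rule frame_trans[OF fr])
        show "frame ?q s s'" by (rule frame_trans[OF fr1 that]) auto
      qed (auto simp: part_raise_cost_def)
      have fr1': "frame (part_raise_cost A e) s\<^sub>0 s\<^sub>1"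
        by (rule frame_trans[OF fr fr1]) (auto simp: part_raise_cost_def)
      \<comment> \<open>A partial sum over the tools of part \<open>l\<close> below
        \<open>j\<close>; the cells finished by earlier outer iterations are carried along.\<close>
      let ?J = "\<lambda>j (s :: memory). ?Inv i s \<and> rmem s A i = (\<Sum>h | h \<in> T l \<and> h < j. max 0 (v i - c h))"
      show "wp (For ''j'' ''n'' ?p) (9 + n * ((2 * K + 38) + 12))
          (\<lambda>s'. ?Inv (Suc i) (iwrite ''i'' 0 (Suc i) s')) s\<^sub>1"
      proof (rule wp_For[where Inv = ?J and m = n])
        fix j s' assume j: "j < n" and fj: "frame (For ''j'' ''n'' ?p) s\<^sub>1 s'"
          and js: "imem s' ''j'' 0 = j" and inv': "?J j s'"
        have e1: "encodes s' I" using enc'[OF fr'[OF fj]] .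
        have ci': "imem s' ''i'' 0 = i"
          using ci frame_imem[OF fr1, of "''i''"] frame_imem[OF fj, of "''i''"] by simp
        have ev: "rval e s' = v i" using e[OF i fr'[OF fj] ci'] .
        have cj: "rmem s' ''c'' j = c j" using e1 j by (auto simp: encodes_def)
        have pi: "imem s' ''part'' i = l" using part_of[OF e1 l] .
        obtain l' where l': "l' \<in> parts" "j \<in> T l'" using part_exists[OF j] by blast
        have pj: "imem s' ''part'' j = l'" using part_of[OF e1 l'] .
        have mem: "j \<in> T l \<longleftrightarrow> l' = l" using l' l T_unique by blast
        have set: "{h. h \<in> T l \<and> h < Suc j} =
            (if l' = l then insert j {h. h \<in> T l \<and> h < j} else {h. h \<in> T l \<and> h < j})"
          using mem by (auto simp: less_Suc_eq)
        have sum: "(\<Sum>h | h \<in> T l \<and> h < Suc j. max 0 (v i - c h)) =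
            (\<Sum>h | h \<in> T l \<and> h < j. max 0 (v i - c h)) + (if l' = l then max 0 (v i - c j) else 0)"
          unfolding set by simp
        show "wp ?p (2 * K + 38) (\<lambda>s'. ?J (Suc j) (iwrite ''j'' 0 (Suc j) s')) s'"
        proof (rule wp_loop_free)
          have "bval (BAnd (BAnd (BNot (ILess this_part (ICell ''part'' (IVar ''j''))))
                    (BNot (ILess (ICell ''part'' (IVar ''j'')) this_part)))
              (RLess (RCell ''c'' (IVar ''j'')) e)) s' \<longleftrightarrow> l' = l \<and> c j < v i"
            by (auto simp: ci' js pi pj cj ev)
          then show "?J (Suc j) (iwrite ''j'' 0 (Suc j) (exec ?p s'))"
            using inv' unfolding exec.simps sum by (auto simp: ci' js cj ev)
        qed (use K in auto)
      next
        fix s' assume "?J n s'"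
        moreover have "{h. h \<in> T l \<and> h < n} = T l" using T_less l(1) by blast
        ultimately show "?Inv (Suc i) (iwrite ''i'' 0 (Suc i) s')"
          using T_other[OF l] by (auto simp: less_Suc_eq raise_cost_def)
      qed (use num_tools_of[OF enc'[OF fr1']] R in auto)
    qed
  next
    fix s assume "frame (For ''i'' ''n'' ?q) s\<^sub>0 s" "?Inv n s"
    then show "Q s" using T_less by (intro post) (auto simp: part_raise_cost_def)
  qed (use num_tools_of[OF enc] in auto)
qed

lemma wp_representatives:
  assumes enc: "encodes s\<^sub>0 I" and M: "\<And>l. l \<in> parts \<Longrightarrow> rmem s\<^sub>0 ''M'' l = Min (C ` T l)"
    and post: "\<And>s. frame representatives s\<^sub>0 s \<Longrightarrow>
      (\<And>l. l \<in> parts \<Longrightarrow> imem s ''a'' l \<in> T l \<and> C (imem s ''a'' l) = Min (C ` T l)) \<Longrightarrow> Q s"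
  shows "wp representatives (9 + n * (15 + 12)) Q s\<^sub>0"
proof -
  let ?ok = "\<lambda>(s :: memory) l. imem s ''a'' l \<in> T l \<and> C (imem s ''a'' l) = Min (C ` T l)"
  \<comment> \<open>Until a minimiser of part \<open>l\<close> has been passed, cell
    \<open>l\<close> of \<open>a\<close> may still hold its arbitrary initial content.\<close>
  let ?Inv = "\<lambda>i (s :: memory). \<forall>l\<in>parts. (\<exists>j\<in>T l. j < i \<and> C j = Min (C ` T l)) \<longrightarrow> ?ok s l"
  let ?p = "Cond (RLess (RCell ''M'' this_part) (RCell ''C'' (IVar ''i'')))
      Skip (IAssign ''a'' this_part (IVar ''i''))"
  show ?thesis
    unfolding representatives_def
  proof (rule wp_For[where Inv = ?Inv and m = n])
    fix i s assume i: "i < n" and fr: "frame (For ''i'' ''n'' ?p) s\<^sub>0 s"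
      and ci: "imem s ''i'' 0 = i" and inv: "?Inv i s"
    have enc': "encodes s I" using enc fr by (rule encodes_frame) auto
    obtain l where l: "l \<in> parts" "i \<in> T l" using part_exists[OF i] by blast
    have pt: "imem s ''part'' i = l" using part_of[OF enc' l] .
    have m: "rmem s ''M'' l = Min (C ` T l)" using M[OF l(1)] frame_rmem[OF fr, of "''M''"] by simp
    have Ci: "rmem s ''C'' i = C i" using enc' i by (auto simp: encodes_def)
    have le: "Min (C ` T l) \<le> C i" using finite_T[OF l(1)] l(2) by (intro Min_le) auto
    show "wp ?p 15 (\<lambda>s'. ?Inv (Suc i) (iwrite ''i'' 0 (Suc i) s')) s"
    proof (rule wp_loop_free)
      show "?Inv (Suc i) (iwrite ''i'' 0 (Suc i) (exec ?p s))"
      proof (cases "Min (C ` T l) < C i")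
        case True
        then have "C i \<noteq> Min (C ` T l')" if "l' \<in> parts" "i \<in> T l'" for l'
          using T_unique[OF l(1) that(1) l(2) that(2)] by auto
        then show ?thesis
          using inv True by (auto simp: ci pt m Ci less_Suc_eq)
      next
        case False
        then show ?thesis
          using inv l T_other[OF l] le by (auto simp: ci pt m Ci less_Suc_eq)
      qed
    qed auto
  next
    fix s assume fr: "frame (For ''i'' ''n'' ?p) s\<^sub>0 s" and inv: "?Inv n s"
    show "Q s"
    proof (rule post)
      show "frame representatives s\<^sub>0 s" using fr by (simp add: representatives_def)
      fix l assume l: "l \<in> parts"
      then obtain i where "i \<in> T l" "Min (C ` T l) = C i"
        using Min_in[of "C ` T l"] finite_T T_nonempty by blast
      then show "?ok s l" using inv l T_less by metis
    qed
  qed (use num_tools_of[OF enc] in auto)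
qed

end

text \<open>For the part \<open>l\<close>, \<open>U l\<close> is the cap, \<open>M l\<close> the smallest first-stage cost and \<open>a l\<close> a tool attaining
  it. For the tool \<open>i\<close>, \<open>p i\<close> is the level it contributes, and \<open>q i\<close>, \<open>r i\<close> are the costs of raising its
  part to \<open>p i\<close> and to the cap.\<close>

definition preprocess :: com where
  "preprocess =
    Seq (part_min ''U'' (RAdd (RCell ''c'' (IVar ''i'')) (RCell ''d'' (IVar ''i''))))
   (Seq (part_min ''M'' (RCell ''C'' (IVar ''i'')))
   (Seq representatives
   (Seq (For ''i'' ''n'' (Cond (RLess (RCell ''c'' (IVar ''i'')) (RCell ''U'' this_part))
           (RAssign ''p'' (IVar ''i'') (RCell ''c'' (IVar ''i'')))
           (RAssign ''p'' (IVar ''i'') (RCell ''U'' this_part))))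
   (Seq (part_raise_cost ''q'' (RCell ''p'' (IVar ''i'')))
        (part_raise_cost ''r'' (RCell ''U'' this_part))))))"

text \<open>\<open>K\<close> holds the index \<open>k\<close> of the multiplier as a real number. \<open>S\<close> becomes the dual value for \<open>k\<close>,
  and \<open>F l\<close> the dual gain of the part \<open>l\<close>.\<close>

definition evaluate :: com where
  "evaluate =
    Seq (part_min ''A'' (RSub (RDiv (RCell ''q'' (IVar ''i'')) (RVar ''K'')) (RCell ''p'' (IVar ''i''))))
   (Seq (RAssign ''S'' (INum 0) (RDiv (RVar ''Gamma'') (RVar ''K'')))
        (For ''h'' ''l''
          (Seq (RAssign ''F'' (IVar ''h'') (RSub (RNum 0) (RCell ''A'' (IVar ''h''))))
          (Seq (RAssign ''B'' (INum 0) (RSub (RCell ''U'' (IVar ''h''))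
                 (RDiv (RCell ''r'' (ICell ''a'' (IVar ''h''))) (RVar ''K''))))
          (Seq (Cond (RLess (RCell ''F'' (IVar ''h'')) (RVar ''B''))
                 (RAssign ''F'' (IVar ''h'') (RVar ''B'')) Skip)
               (Cond (RLess (RCell ''M'' (IVar ''h'')) (RCell ''F'' (IVar ''h'')))
                 (RAssign ''S'' (INum 0) (RAdd (RVar ''S'') (RCell ''M'' (IVar ''h''))))
                 (RAssign ''S'' (INum 0) (RAdd (RVar ''S'') (RCell ''F'' (IVar ''h''))))))))))"

text \<open>Clearing \<open>x\<close> erases both arbitrary initial contents and an earlier
  incumbent. The strict test buys the same parts as \<open>optimal_selection\<close>.\<close>

definition record_solution :: com where
  "record_solution =
    Seq (RAssign ''opt'' (INum 0) (RVar ''S''))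
   (Seq (For ''i'' ''n'' (RAssign ''x'' (IVar ''i'') (RNum 0)))
        (For ''h'' ''l'' (Cond (RLess (RCell ''M'' (IVar ''h'')) (RCell ''F'' (IVar ''h'')))
          (RAssign ''x'' (ICell ''a'' (IVar ''h'')) (RNum 1)) Skip)))"

text \<open>\<open>m\<close> is \<open>n + 1\<close>, so \<open>k\<close> runs from \<open>0\<close>
  to \<open>n\<close>. \<open>K\<close> mirrors the counter \<open>k\<close> as a real, since the
  machine cannot convert. The test \<open>0 < k\<close> forces the first candidate to be recorded,
  because \<open>opt\<close> is arbitrary before that.\<close>

definition solver :: com where
  "solver =
    Seq preprocess
   (Seq (Seq (IAssign ''m'' (INum 0) (IAdd (IVar ''n'') (INum 1))) (RAssign ''K'' (INum 0) (RNum 0)))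
        (For ''k'' ''m''
          (Seq evaluate
          (Seq (Cond (BAnd (ILess (INum 0) (IVar ''k'')) (BNot (RLess (RVar ''S'') (RVar ''opt''))))
                 Skip record_solution)
               (RAssign ''K'' (INum 0) (RAdd (RVar ''K'') (RNum 1)))))))"

context part
begin

text \<open>The form that \<open>evaluate\<close> computes: the cap is treated separately, and the
  maximum over the other levels becomes a negated minimum, so that \<open>part_min\<close> can be
  reused.\<close>

lemma dual_gain_eq:
  "dual_gain S c d k = max (u - raise_cost S c u / real k)
     (- Min ((\<lambda>i. raise_cost S c (min (c i) u) / real k - min (c i) u) ` S))"
proof -
  let ?f = "\<lambda>i. raise_cost S c (min (c i) u) / real k - min (c i) u"
  have "Max ((\<lambda>i. - ?f i) ` S) = - Min (?f ` S)"
  proof (rule Max_eqI)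
    obtain i where "i \<in> S" "Min (?f ` S) = ?f i"
      using Min_in[of "?f ` S"] finite nonempty by blast
    then show "- Min (?f ` S) \<in> (\<lambda>i. - ?f i) ` S" by auto
    fix y assume "y \<in> (\<lambda>i. - ?f i) ` S"
    then obtain i where "i \<in> S" "y = - ?f i" by blast
    moreover have "Min (?f ` S) \<le> ?f i" using \<open>i \<in> S\<close> finite by (intro Min_le) auto
    ultimately show "y \<le> - Min (?f ` S)" by simp
  qed (use finite in simp)
  moreover have "(\<lambda>p. p - raise_cost S c p / real k) ` levels S c d =
      insert (u - raise_cost S c u / real k) ((\<lambda>i. - ?f i) ` S)"
    by (auto simp: levels_def image_iff)
  ultimately show ?thesis
    unfolding dual_gain_def using finite nonempty by simp
qed

end

section \<open>Preprocessing, evaluation of a multiplier and recording\<close>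

context rs_instance
begin

text \<open>All that the evaluations rely on; nothing in it depends on the multiplier.\<close>

definition prepared :: "memory \<Rightarrow> bool" where
  "prepared s \<longleftrightarrow> encodes s I \<and> (\<forall>l\<in>parts.
     rmem s ''U'' l = cap (T l) c d \<and> rmem s ''M'' l = Min (C ` T l) \<and>
     imem s ''a'' l \<in> T l \<and> C (imem s ''a'' l) = Min (C ` T l) \<and>
     (\<forall>i\<in>T l. rmem s ''p'' i = min (c i) (cap (T l) c d) \<and>
        rmem s ''q'' i = raise_cost (T l) c (min (c i) (cap (T l) c d)) \<and>
        rmem s ''r'' i = raise_cost (T l) c (cap (T l) c d)))"

lemma prepared_frame:
  assumes "prepared s" "frame p s s'"
    "{''n'', ''l'', ''part'', ''a''} \<inter> iwrites p = {}"
    "{''C'', ''c'', ''d'', ''Gamma'', ''U'', ''M'', ''p'', ''q'', ''r''} \<inter> rwrites p = {}"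
  shows "prepared s'"
proof -
  have "imem s' ''a'' = imem s ''a''" "rmem s' ''U'' = rmem s ''U''" "rmem s' ''M'' = rmem s ''M''"
    "rmem s' ''p'' = rmem s ''p''" "rmem s' ''q'' = rmem s ''q''" "rmem s' ''r'' = rmem s ''r''"
    using assms(2-) by (auto simp: frame_def)
  moreover have "encodes s' I"
    using assms by (intro encodes_frame[OF _ assms(2)]) (auto simp: prepared_def)
  ultimately show ?thesis using assms(1) by (simp add: prepared_def)
qed

text \<open>Turns values that depend on a tool and its part into functions of the tool alone, the
  form that \<open>wp_part_min\<close> and \<open>wp_part_raise_cost\<close> expect for
  \<open>v\<close>.\<close>

definition the_part :: "nat \<Rightarrow> nat" where
  "the_part i = (THE l. l \<in> parts \<and> i \<in> T l)"

lemma part_eq: "l \<in> parts \<Longrightarrow> i \<in> T l \<Longrightarrow> the_part i = l"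
  unfolding the_part_def using T_unique by (intro the_equality) auto

lemma cell_inputs:
  assumes "encodes s I" "i < n"
  shows "rmem s ''C'' i = C i" "rmem s ''c'' i = c i" "rmem s ''d'' i = d i"
  using assms by (auto simp: encodes_def)

lemma wp_preprocess:
  assumes enc: "encodes s\<^sub>0 I" and post: "\<And>s. prepared s \<Longrightarrow> Q s"
  shows "wp preprocess (1000 * (n + 1)\<^sup>2) Q s\<^sub>0"
proof -
  \<comment> \<open>One assertion per table. Each stage adds its own and carries the earlier ones
    through its frame.\<close>
  let ?U = "\<lambda>s :: memory. \<forall>l\<in>parts. rmem s ''U'' l = cap (T l) c d"
  let ?M = "\<lambda>s :: memory. \<forall>l\<in>parts. rmem s ''M'' l = Min (C ` T l)"
  let ?a = "\<lambda>s :: memory. \<forall>l\<in>parts. imem s ''a'' l \<in> T l \<and> C (imem s ''a'' l) = Min (C ` T l)"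
  let ?p = "\<lambda>s :: memory. \<forall>l\<in>parts. \<forall>i\<in>T l. rmem s ''p'' i = min (c i) (cap (T l) c d)"
  let ?q = "\<lambda>s :: memory. \<forall>l\<in>parts. \<forall>i\<in>T l.
    rmem s ''q'' i = raise_cost (T l) c (min (c i) (cap (T l) c d))"
  have 1: "wp (part_min ''U'' (RAdd (RCell ''c'' (IVar ''i'')) (RCell ''d'' (IVar ''i''))))
     ((9 + n * ((7 + 4) + 12)) + (9 + n * ((2 * 7 + 10) + 12))) (\<lambda>s. encodes s I \<and> ?U s) s"
    if s: "encodes s I" for s
  proof (rule wp_part_min[OF s, where v = "\<lambda>i. c i + d i"], goal_cases)
    case (2 s' i)
    then show ?case using encodes_frame[OF s 2(2)] by (auto simp: part_min_def cell_inputs)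
  next
    case (4 s')
    then show ?case using encodes_frame[OF s 4(1)] by (auto simp: part_min_def cap_def)
  qed auto
  have 2: "wp (part_min ''M'' (RCell ''C'' (IVar ''i'')))
     ((9 + n * ((7 + 4) + 12)) + (9 + n * ((2 * 7 + 10) + 12))) (\<lambda>s. (encodes s I \<and> ?U s) \<and> ?M s) s"
    if s: "encodes s I \<and> ?U s" for s
  proof (rule wp_part_min[where v = C], goal_cases)
    case 1 show ?case using s by simp
  next
    case (3 s' i)
    then show ?case using encodes_frame[OF _ 3(2)] s by (auto simp: part_min_def cell_inputs)
  next
    case (5 s')
    then show ?case
      using encodes_frame[OF _ 5(1)] frame_rmem[OF 5(1), of "''U''"] s by (auto simp: part_min_def)
  qed auto
  have 3: "wp representatives (9 + n * (15 + 12)) (\<lambda>s. ((encodes s I \<and> ?U s) \<and> ?M s) \<and> ?a s) s"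
    if s: "(encodes s I \<and> ?U s) \<and> ?M s" for s
  proof (rule wp_representatives, goal_cases)
    case (3 s')
    then show ?case
      using encodes_frame[OF _ 3(1)] frame_rmem[OF 3(1), of "''U''"] frame_rmem[OF 3(1), of "''M''"] s
      by (auto simp: representatives_def)
  qed (use s in auto)
  let ?body = "Cond (RLess (RCell ''c'' (IVar ''i'')) (RCell ''U'' this_part))
           (RAssign ''p'' (IVar ''i'') (RCell ''c'' (IVar ''i'')))
           (RAssign ''p'' (IVar ''i'') (RCell ''U'' this_part))"
  let ?P4 = "\<lambda>s. (((encodes s I \<and> ?U s) \<and> ?M s) \<and> ?a s) \<and> ?p s"
  have 4: "wp (For ''i'' ''n'' ?body) (9 + n * (20 + 12)) ?P4 s"
    if s: "((encodes s I \<and> ?U s) \<and> ?M s) \<and> ?a s" for s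
  proof (rule wp_For[where m = n and
        Inv = "\<lambda>i s. \<forall>l\<in>parts. \<forall>j\<in>T l. j < i \<longrightarrow> rmem s ''p'' j = min (c j) (cap (T l) c d)"],
      goal_cases)
    case (7 i s')
    obtain l where l: "l \<in> parts" "i \<in> T l" using part_exists[OF 7(1)] by blast
    have e: "encodes s' I" using encodes_frame[OF _ 7(2)] s by auto
    have U: "rmem s' ''U'' l = cap (T l) c d" using frame_rmem[OF 7(2), of "''U''"] s l by auto
    show ?case
      using 7(3,4) part_of[OF e l] U cell_inputs[OF e 7(1)] T_unique[OF l(1) _ l(2)]
      by (intro wp_loop_free) (auto simp: less_Suc_eq min_def)
  next
    case (8 s')
    have e: "encodes s' I" using encodes_frame[OF _ 8(1)] s by auto
    then show ?case
      using 8(2) s frame_rmem[OF 8(1), of "''U''"] frame_rmem[OF 8(1), of "''M''"]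
        frame_imem[OF 8(1), of "''a''"] T_less by auto
  qed (use s num_tools_of in auto)
  have 5: "wp (part_raise_cost ''q'' (RCell ''p'' (IVar ''i'')))
     (9 + n * ((4 + (9 + n * ((2 * 5 + 38) + 12))) + 12)) (\<lambda>s. ?P4 s \<and> ?q s) s"
    if s: "?P4 s" for s
  proof (rule wp_part_raise_cost[where v = "\<lambda>i. min (c i) (cap (T (the_part i)) c d)"], goal_cases)
    case (3 s' i)
    obtain l where l: "l \<in> parts" "i \<in> T l" using part_exists[OF 3(1)] by blast
    then show ?case
      using 3(3) s frame_rmem[OF 3(2), of "''p''"] part_eq[OF l] by (auto simp: part_raise_cost_def)
  next
    case (5 s')
    have e: "encodes s' I" using encodes_frame[OF _ 5(1)] s by (auto simp: part_raise_cost_def)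
    show ?case
      using e s frame_rmem[OF 5(1), of "''U''"] frame_rmem[OF 5(1), of "''M''"]
        frame_rmem[OF 5(1), of "''p''"] frame_imem[OF 5(1), of "''a''"] 5(2)
      by (simp add: part_raise_cost_def part_eq)
  qed (use s in auto)
  have 6: "wp (part_raise_cost ''r'' (RCell ''U'' this_part))
     (9 + n * ((4 + (9 + n * ((2 * 5 + 38) + 12))) + 12)) Q s"
    if s: "?P4 s \<and> ?q s" for s
  proof (rule wp_part_raise_cost[where v = "\<lambda>i. cap (T (the_part i)) c d"], goal_cases)
    case (3 s' i)
    have e: "encodes s' I" using encodes_frame[OF _ 3(2)] s by (auto simp: part_raise_cost_def)
    obtain l where l: "l \<in> parts" "i \<in> T l" using part_exists[OF 3(1)] by blast
    then show ?case
      using 3(3) s frame_rmem[OF 3(2), of "''U''"] part_eq[OF l] part_of[OF e l]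
      by (auto simp: part_raise_cost_def)
  next
    case (5 s')
    have e: "encodes s' I" using encodes_frame[OF _ 5(1)] s by (auto simp: part_raise_cost_def)
    have "prepared s'"
      using e s frame_rmem[OF 5(1), of "''U''"] frame_rmem[OF 5(1), of "''M''"]
        frame_rmem[OF 5(1), of "''p''"] frame_rmem[OF 5(1), of "''q''"]
        frame_imem[OF 5(1), of "''a''"] 5(2)
      by (simp add: part_raise_cost_def part_eq prepared_def)
    then show ?case by (rule post)
  qed (use s in auto)
  show ?thesis
    unfolding preprocess_def
    \<comment> \<open>Only the two calls of \<open>part_raise_cost\<close> are quadratic, with
      leading coefficient 60 each.\<close>
    by (rule wp_mono[OF wp_Seq[OF 1[OF enc] wp_Seq[OF 2 wp_Seq[OF 3 wp_Seq[OF 4 wp_Seq[OF 5 6]]]]]])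
      (auto simp: power2_eq_square algebra_simps)
qed

lemma wp_evaluate:
  assumes prep: "prepared s\<^sub>0" and K: "rmem s\<^sub>0 ''K'' 0 = real k"
    and post: "\<And>s. frame evaluate s\<^sub>0 s \<Longrightarrow> rmem s ''S'' 0 = dual_value I k \<Longrightarrow>
      (\<And>l. l \<in> parts \<Longrightarrow> rmem s ''F'' l = gain l k) \<Longrightarrow> Q s"
  shows "wp evaluate (200 * (n + 1)) Q s\<^sub>0"
proof -
  let ?A = "part_min ''A'' (RSub (RDiv (RCell ''q'' (IVar ''i'')) (RVar ''K'')) (RCell ''p'' (IVar ''i'')))"
  let ?B = "RAssign ''S'' (INum 0) (RDiv (RVar ''Gamma'') (RVar ''K''))"
  let ?body = "(Seq (RAssign ''F'' (IVar ''h'') (RSub (RNum 0) (RCell ''A'' (IVar ''h''))))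
          (Seq (RAssign ''B'' (INum 0) (RSub (RCell ''U'' (IVar ''h''))
                 (RDiv (RCell ''r'' (ICell ''a'' (IVar ''h''))) (RVar ''K''))))
          (Seq (Cond (RLess (RCell ''F'' (IVar ''h'')) (RVar ''B''))
                 (RAssign ''F'' (IVar ''h'') (RVar ''B'')) Skip)
               (Cond (RLess (RCell ''M'' (IVar ''h'')) (RCell ''F'' (IVar ''h'')))
                 (RAssign ''S'' (INum 0) (RAdd (RVar ''S'') (RCell ''M'' (IVar ''h''))))
                 (RAssign ''S'' (INum 0) (RAdd (RVar ''S'') (RCell ''F'' (IVar ''h''))))))))"
  let ?C = "For ''h'' ''l'' ?body"
  \<comment> \<open>The negated Lagrangian at the level of tool \<open>i\<close>, as
    \<open>part_min\<close> minimises.\<close>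
  define w where "w l i = raise_cost (T l) c (min (c i) (cap (T l) c d)) / real k - min (c i) (cap (T l) c d)" for l i
  let ?P = "\<lambda>s :: memory. prepared s \<and> rmem s ''K'' 0 = real k \<and> frame evaluate s\<^sub>0 s \<and>
     (\<forall>l\<in>parts. rmem s ''A'' l = Min (w l ` T l))"
  let ?m = "\<lambda>l. min (Min (C ` T l)) (gain l k)"
  have 1: "wp ?A ((9 + n * ((10 + 4) + 12)) + (9 + n * ((2 * 10 + 10) + 12))) ?P s\<^sub>0"
  proof (rule wp_part_min[where v = "\<lambda>i. w (the_part i) i"], goal_cases)
    case (3 s i)
    have p: "prepared s" using prepared_frame[OF prep 3(2)] by (auto simp: part_min_def)
    obtain l where l: "l \<in> parts" "i \<in> T l" using part_exists[OF 3(1)] by blast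
    then show ?case
      using p 3(3) K frame_rmem[OF 3(2), of "''K''"] part_eq[OF l]
      by (auto simp: part_min_def prepared_def w_def)
  next
    case (5 s)
    have p: "prepared s" using prepared_frame[OF prep 5(1)] by (auto simp: part_min_def)
    have "frame evaluate s\<^sub>0 s" using 5(1) by (rule frame_mono) (auto simp: evaluate_def)
    moreover have "(\<lambda>i. w (the_part i) i) ` T l = w l ` T l" if "l \<in> parts" for l
      using part_eq[OF that] by (intro image_cong) auto
    ultimately show ?case
      using p 5(2) K frame_rmem[OF 5(1), of "''K''"] by (auto simp: part_min_def)
  qed (use prep in \<open>auto simp: prepared_def\<close>)
  let ?R = "\<lambda>s. ?P s \<and> rmem s ''S'' 0 = budget I / real k"
  have 2: "wp ?B 7 ?R s" if s: "?P s" for s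
  proof (rule wp_loop_free)
    have fr: "frame ?B s (exec ?B s)" by (auto simp: frame_def)
    have "prepared (exec ?B s)" using s by (intro prepared_frame[OF _ fr]) auto
    moreover have "frame evaluate s\<^sub>0 (exec ?B s)"
    proof (rule frame_trans[OF _ fr])
      show "frame evaluate s\<^sub>0 s" using s by blast
    qed (auto simp: evaluate_def)
    moreover have "rmem s ''Gamma'' 0 = budget I" using s by (auto simp: prepared_def encodes_def)
    ultimately show "?R (exec ?B s)" using s by simp
  qed auto
  have 3: "wp ?C (9 + n * (70 + 12)) Q s" if s: "?R s" for s
  proof (rule wp_For[where m = "num_parts I" and Inv = "\<lambda>i s.
       rmem s ''S'' 0 = budget I / real k + sum ?m {..<i} \<and> (\<forall>l<i. rmem s ''F'' l = gain l k)"],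
      goal_cases)
    case (7 l s')
    have l: "l \<in> parts" using 7(1) by simp
    have p: "prepared s'" using prepared_frame[OF _ 7(2)] s by auto
    \<comment> \<open>\<open>r\<close> is indexed by tools, so the representative of part
      \<open>l\<close> gives access to the cost of reaching its cap.\<close>
    have a: "rmem s' ''r'' (imem s' ''a'' l) = raise_cost (T l) c (cap (T l) c d)"
        "rmem s' ''U'' l = cap (T l) c d" "rmem s' ''M'' l = Min (C ` T l)"
      using p l unfolding prepared_def by blast+
    have r: "rmem s' ''K'' 0 = real k" "rmem s' ''A'' l = Min (w l ` T l)"
      using s l frame_rmem[OF 7(2), of "''K''"] frame_rmem[OF 7(2), of "''A''"] by auto
    have g: "gain l k = max (cap (T l) c d - raise_cost (T l) c (cap (T l) c d) / real k)
        (- Min (w l ` T l))"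
      using part.dual_gain_eq[OF part_T[OF l]] by (simp add: w_def)
    show ?case
    proof (rule wp_loop_free)
      have F: "rmem (exec ?body s') ''F'' = (rmem s' ''F'')(l := gain l k)"
        and S: "rmem (exec ?body s') ''S'' = (rmem s' ''S'')(0 := rmem s' ''S'' 0 + ?m l)"
        by (auto simp: 7(3) a r g)
      show "rmem (iwrite ''h'' 0 (Suc l) (exec ?body s')) ''S'' 0 = budget I / real k + sum ?m {..<Suc l} \<and>
          (\<forall>j<Suc l. rmem (iwrite ''h'' 0 (Suc l) (exec ?body s')) ''F'' j = gain j k)"
        unfolding mem_write F S using 7(4) by (simp add: less_Suc_eq)
    qed auto
  next
    case (8 s')
    have "frame evaluate s\<^sub>0 s'"
    proof (rule frame_trans[OF _ 8(1)])
      show "frame evaluate s\<^sub>0 s" using s by blast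
    qed (auto simp: evaluate_def)
    then show ?case using 8(2) by (intro post) (auto simp: dual_value_def)
  qed (use s num_parts_le in \<open>auto simp: prepared_def encodes_def\<close>)
  show ?thesis
    unfolding evaluate_def
    by (rule wp_mono[OF wp_Seq[OF 1 wp_Seq[OF 2 3]]]) auto
qed

lemma wp_record_solution:
  assumes prep: "prepared s\<^sub>0" and F: "\<And>l. l \<in> parts \<Longrightarrow> rmem s\<^sub>0 ''F'' l = gain l k"
    and post: "\<And>s. frame record_solution s\<^sub>0 s \<Longrightarrow> rmem s ''opt'' 0 = rmem s\<^sub>0 ''S'' 0 \<Longrightarrow>
      (\<And>i. i < n \<Longrightarrow> rmem s ''x'' i =
         selection (imem s\<^sub>0 ''a'') {l\<in>parts. Min (C ` T l) < gain l k} i) \<Longrightarrow> Q s"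
  shows "wp record_solution (100 * (n + 1)) Q s\<^sub>0"
proof -
  let ?A = "RAssign ''opt'' (INum 0) (RVar ''S'')"
  let ?x = "RAssign ''x'' (IVar ''i'') (RNum 0)"
  let ?y = "Cond (RLess (RCell ''M'' (IVar ''h'')) (RCell ''F'' (IVar ''h'')))
          (RAssign ''x'' (ICell ''a'' (IVar ''h'')) (RNum 1)) Skip"
  let ?P = "\<lambda>s :: memory. frame record_solution s\<^sub>0 s \<and> rmem s ''opt'' 0 = rmem s\<^sub>0 ''S'' 0"
  let ?a = "imem s\<^sub>0 ''a''"
  let ?L = "\<lambda>m. {l\<in>parts. Min (C ` T l) < gain l k \<and> l < m}"
  have prep': "prepared s" if "frame record_solution s\<^sub>0 s" for s
    using prepared_frame[OF prep that] by (auto simp: record_solution_def)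
  have 1: "wp ?A 5 ?P s\<^sub>0"
    by (rule wp_loop_free) (auto simp: frame_def record_solution_def)
  have 2: "wp (For ''i'' ''n'' ?x) (9 + n * (5 + 12)) (\<lambda>s. ?P s \<and> (\<forall>i<n. rmem s ''x'' i = 0)) s"
    if s: "?P s" for s
  proof (rule wp_For[where m = n and Inv = "\<lambda>i s. \<forall>j<i. rmem s ''x'' j = 0"], goal_cases)
    case 4
    then show ?case using s prep' num_tools_of by (auto simp: prepared_def)
  next
    case (7 i s')
    then show ?case by (intro wp_loop_free) (auto simp: less_Suc_eq)
  next
    case (8 s')
    have "frame record_solution s\<^sub>0 s'"
    proof (rule frame_trans[OF _ 8(1)])
      show "frame record_solution s\<^sub>0 s" using s by blast
    qed (auto simp: record_solution_def)
    then show ?case using 8(2) s frame_rmem[OF 8(1), of "''opt''"] by auto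
  qed auto
  have 3: "wp (For ''h'' ''l'' ?y) (9 + n * (20 + 12)) Q s" if s: "?P s \<and> (\<forall>i<n. rmem s ''x'' i = 0)" for s
  proof (rule wp_For[where m = "num_parts I" and
        Inv = "\<lambda>m s. \<forall>i<n. rmem s ''x'' i = selection ?a (?L m) i"], goal_cases)
    case 4
    then show ?case using s prep' by (auto simp: prepared_def encodes_def)
  next
    case 5
    then show ?case by (rule num_parts_le)
  next
    case 6
    then show ?case using s by (simp add: selection_def)
  next
    case (7 l s')
    have l: "l \<in> parts" using 7(1) by simp
    have fr: "frame record_solution s\<^sub>0 s'"
    proof (rule frame_trans[OF _ 7(2)])
      show "frame record_solution s\<^sub>0 s" using s by blast
    qed (auto simp: record_solution_def)
    have M: "rmem s' ''M'' l = Min (C ` T l)" using prep'[OF fr] l by (auto simp: prepared_def)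
    have F': "rmem s' ''F'' l = gain l k" "imem s' ''a'' = ?a"
      using F[OF l] frame_rmem[OF fr, of "''F''"] frame_imem[OF fr, of "''a''"]
      by (auto simp: record_solution_def)
    have L: "?L (Suc l) = (if Min (C ` T l) < gain l k then insert l (?L l) else ?L l)"
      using l by (auto simp: less_Suc_eq)
    show ?case
    proof (rule wp_loop_free)
      have "exec ?y s' = (if Min (C ` T l) < gain l k then rwrite ''x'' (?a l) 1 s' else s')"
        using 7(3) by (simp add: M F')
      then show "\<forall>i<n. rmem (iwrite ''h'' 0 (Suc l) (exec ?y s')) ''x'' i = selection ?a (?L (Suc l)) i"
        unfolding L using 7(4) by (auto simp: selection_def)
    qed auto
  next
    case (8 s')
    have fr: "frame record_solution s\<^sub>0 s'"
    proof (rule frame_trans[OF _ 8(1)])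
      show "frame record_solution s\<^sub>0 s" using s by blast
    qed (auto simp: record_solution_def)
    have "?L (num_parts I) = {l\<in>parts. Min (C ` T l) < gain l k}" by auto
    then show ?case using 8(2) s frame_rmem[OF 8(1), of "''opt''"] by (intro post[OF fr]) auto
  qed auto
  show ?thesis
    unfolding record_solution_def
    by (rule wp_mono[OF wp_Seq[OF 1 wp_Seq[OF 2 3]]]) auto
qed

end

section \<open>The loop over the multipliers\<close>

context rs_instance
begin

text \<open>Vacuous for \<open>k = 0\<close>, when \<open>opt\<close> and \<open>x\<close> still
  have arbitrary contents. The best index \<open>j\<close> is not stored, hence the existential
  quantifier.\<close>

definition incumbent :: "nat \<Rightarrow> memory \<Rightarrow> bool" where
  "incumbent k s \<longleftrightarrow> (0 < k \<longrightarrow> (\<exists>j<k. rmem s ''opt'' 0 = dual_value I j \<and>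
     (\<forall>j'<k. dual_value I j \<le> dual_value I j') \<and>
     (\<forall>i<n. rmem s ''x'' i = selection (imem s ''a'') {l\<in>parts. Min (C ` T l) < gain l j} i)))"

lemma incumbent_solves:
  assumes "prepared s" "incumbent (Suc n) s"
  shows "holds_solution s I"
proof -
  obtain j where j: "j \<le> n" "\<And>j'. j' \<le> n \<Longrightarrow> dual_value I j \<le> dual_value I j'"
    and opt: "rmem s ''opt'' 0 = dual_value I j"
    and x: "\<And>i. i < n \<Longrightarrow>
      rmem s ''x'' i = selection (imem s ''a'') {l\<in>parts. Min (C ` T l) < gain l j} i"
    using assms(2) by (auto simp: incumbent_def less_Suc_eq_le)
  have "\<And>l. l \<in> parts \<Longrightarrow> imem s ''a'' l \<in> T l" "\<And>l. l \<in> parts \<Longrightarrow> C (imem s ''a'' l) = Min (C ` T l)"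
    using assms(1) by (auto simp: prepared_def)
  note sol = optimal_selection[OF j this]
  show ?thesis
    unfolding holds_solution_def
  proof (intro conjI bexI)
    show "rmem s ''opt'' 0 = optimal_value I" using opt sol(3) by simp
  qed (use x sol(1,2) in blast)+
qed

lemma wp_solver:
  assumes enc: "encodes s I"
  shows "wp solver (2000 * (n + 1)\<^sup>2) (\<lambda>s. holds_solution s I) s"
proof -
  let ?init = "Seq (IAssign ''m'' (INum 0) (IAdd (IVar ''n'') (INum 1))) (RAssign ''K'' (INum 0) (RNum 0))"
  let ?c = "Cond (BAnd (ILess (INum 0) (IVar ''k'')) (BNot (RLess (RVar ''S'') (RVar ''opt''))))
                 Skip record_solution"
  let ?inc = "RAssign ''K'' (INum 0) (RAdd (RVar ''K'') (RNum 1))"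
  let ?body = "Seq evaluate (Seq ?c ?inc)"
  let ?I = "\<lambda>k s. prepared s \<and> rmem s ''K'' 0 = real k \<and> incumbent k s"
  let ?P = "\<lambda>s. prepared s \<and> rmem s ''K'' 0 = 0 \<and> imem s ''m'' 0 = Suc n"
  have init: "wp ?init 9 ?P s" if s: "prepared s" for s
  proof (rule wp_loop_free)
    have "frame ?init s (exec ?init s)" by (auto simp: frame_def)
    then have "prepared (exec ?init s)" by (rule prepared_frame[OF s]) auto
    moreover have "imem s ''n'' 0 = n" using s num_tools_of by (auto simp: prepared_def)
    ultimately show "?P (exec ?init s)" by simp
  qed auto
  have inc: "wp ?inc 6 (\<lambda>s'. ?I (Suc k) (iwrite ''k'' 0 (Suc k) s')) s"
    if s: "prepared s" "rmem s ''K'' 0 = real k" "incumbent (Suc k) s" for k s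
  proof (rule wp_loop_free)
    let ?s = "iwrite ''k'' 0 (Suc k) (exec ?inc s)"
    \<comment> \<open>\<open>frame\<close> depends only on the banks written, so a dummy assignment
      to \<open>k\<close> can stand for the increment.\<close>
    have "frame (Seq ?inc (IAssign ''k'' (INum 0) (INum 0))) s ?s" by (auto simp: frame_def)
    then have "prepared ?s" by (rule prepared_frame[OF s(1)]) auto
    then show "?I (Suc k) ?s" using s(2,3) by (simp add: incumbent_def)
  qed auto
  have step: "wp ?c (11 + 1 + 100 * (n + 1)) (\<lambda>s. prepared s \<and> rmem s ''K'' 0 = real k \<and> incumbent (Suc k) s) s"
    if s: "prepared s" "rmem s ''K'' 0 = real k" "incumbent k s" "imem s ''k'' 0 = k"
      "rmem s ''S'' 0 = dual_value I k" "\<And>l. l \<in> parts \<Longrightarrow> rmem s ''F'' l = gain l k" for k s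
  proof (rule wp_mono[OF wp_Cond[where k = "100 * (n + 1)"]])
    assume "bval (BAnd (ILess (INum 0) (IVar ''k'')) (BNot (RLess (RVar ''S'') (RVar ''opt'')))) s"
    then have k: "0 < k" "rmem s ''opt'' 0 \<le> dual_value I k" using s by auto
    then have "incumbent (Suc k) s" using s(3) by (fastforce simp: incumbent_def less_Suc_eq)
    then show "wp Skip (100 * (n + 1))
        (\<lambda>s. prepared s \<and> rmem s ''K'' 0 = real k \<and> incumbent (Suc k) s) s"
      using s by (intro wp_loop_free) auto
  next
    assume "\<not> bval (BAnd (ILess (INum 0) (IVar ''k'')) (BNot (RLess (RVar ''S'') (RVar ''opt'')))) s"
    then have k: "k = 0 \<or> dual_value I k < rmem s ''opt'' 0" using s by auto
    \<comment> \<open>For \<open>k > 0\<close> the incumbent is the smallest value so far, so a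
      candidate below it is below all earlier ones.\<close>
    have "dual_value I k \<le> dual_value I j" if "j < Suc k" for j
      using k that s(3) unfolding incumbent_def by (force simp: less_Suc_eq)
    note min = this
    show "wp record_solution (100 * (n + 1))
        (\<lambda>s. prepared s \<and> rmem s ''K'' 0 = real k \<and> incumbent (Suc k) s) s"
    proof (rule wp_record_solution[OF s(1) s(6)])
      fix s' assume fr: "frame record_solution s s'" and opt: "rmem s' ''opt'' 0 = rmem s ''S'' 0"
        and x: "\<And>i. i < n \<Longrightarrow>
          rmem s' ''x'' i = selection (imem s ''a'') {l\<in>parts. Min (C ` T l) < gain l k} i"
      have "prepared s'" by (rule prepared_frame[OF s(1) fr]) (auto simp: record_solution_def)
      moreover have "rmem s' ''K'' = rmem s ''K''" "imem s' ''a'' = imem s ''a''"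
        using fr by (auto simp: frame_def record_solution_def)
      moreover have "incumbent (Suc k) s'"
        unfolding incumbent_def using min x opt s(5) calculation(3)
        by (intro impI exI[of _ k]) auto
      ultimately show "prepared s' \<and> rmem s' ''K'' 0 = real k \<and> incumbent (Suc k) s'"
        using s(2) by simp
    qed
  qed auto
  have loop: "wp (For ''k'' ''m'' ?body)
      (9 + Suc n * ((200 * (n + 1) + ((11 + 1 + 100 * (n + 1)) + 6)) + 12)) (\<lambda>s. holds_solution s I) s"
    if s: "?P s" for s
  proof (rule wp_For[where m = "Suc n" and Inv = ?I], goal_cases)
    case 6
    have fr: "frame (IAssign ''k'' (INum 0) (INum 0)) s (iwrite ''k'' 0 0 s)"
      by (auto simp: frame_def)
    have "prepared s" using s by blast
    then have "prepared (iwrite ''k'' 0 0 s)" by (rule prepared_frame[OF _ fr]) auto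
    then show ?case using s by (simp add: incumbent_def)
  next
    case (7 k s')
    then have s': "prepared s'" "rmem s' ''K'' 0 = real k" "incumbent k s'" by auto
    show ?case
    proof (rule wp_Seq[where R = "\<lambda>s. prepared s \<and> rmem s ''K'' 0 = real k \<and> incumbent k s \<and>
        imem s ''k'' 0 = k \<and> rmem s ''S'' 0 = dual_value I k \<and> (\<forall>l\<in>parts. rmem s ''F'' l = gain l k)"])
      show "wp evaluate (200 * (n + 1)) (\<lambda>s. prepared s \<and> rmem s ''K'' 0 = real k \<and> incumbent k s \<and>
        imem s ''k'' 0 = k \<and> rmem s ''S'' 0 = dual_value I k \<and> (\<forall>l\<in>parts. rmem s ''F'' l = gain l k)) s'"
      proof (rule wp_evaluate[OF s'(1,2)])
        fix t assume fr: "frame evaluate s' t" and t: "rmem t ''S'' 0 = dual_value I k"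
          "\<And>l. l \<in> parts \<Longrightarrow> rmem t ''F'' l = gain l k"
        have "prepared t" by (rule prepared_frame[OF s'(1) fr]) (auto simp: evaluate_def part_min_def)
        moreover have "rmem t ''K'' = rmem s' ''K''" "rmem t ''opt'' = rmem s' ''opt''"
            "rmem t ''x'' = rmem s' ''x''" "imem t ''a'' = imem s' ''a''" "imem t ''k'' = imem s' ''k''"
          using fr by (auto simp: frame_def evaluate_def part_min_def)
        ultimately show "prepared t \<and> rmem t ''K'' 0 = real k \<and> incumbent k t \<and>
            imem t ''k'' 0 = k \<and> rmem t ''S'' 0 = dual_value I k \<and> (\<forall>l\<in>parts. rmem t ''F'' l = gain l k)"
          using t s' 7(3) by (simp add: incumbent_def)
      qed
    next
      fix t assume "prepared t \<and> rmem t ''K'' 0 = real k \<and> incumbent k t \<and>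
            imem t ''k'' 0 = k \<and> rmem t ''S'' 0 = dual_value I k \<and> (\<forall>l\<in>parts. rmem t ''F'' l = gain l k)"
      then show "wp (Seq ?c ?inc) ((11 + 1 + 100 * (n + 1)) + 6)
          (\<lambda>s'. ?I (Suc k) (iwrite ''k'' 0 (Suc k) s')) t"
        by (intro wp_Seq[OF step inc]) auto
    qed
  next
    case (8 s')
    then show ?case using incumbent_solves by blast
  qed (use s in \<open>auto simp: evaluate_def record_solution_def part_min_def\<close>)
  show ?thesis
    unfolding solver_def
    \<comment> \<open>Each of the \<open>n + 1\<close> iterations costs at most
      \<open>300 * (n + 1) + 30\<close>, so the loop is quadratic like the preprocessing.\<close>
    by (rule wp_mono[OF wp_Seq[OF wp_preprocess[OF enc, where Q = prepared] wp_Seq[OF init loop]]])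
      (auto simp: power2_eq_square algebra_simps)
qed

end

theorem theorem19:
  shows "\<exists>(p :: com) (T :: nat \<Rightarrow> nat).
           (\<lambda>n. real (T n)) \<in> O(\<lambda>n. (real n)\<^sup>2 * ln (real n)) \<and>
           (\<forall>I. valid_instance I \<longrightarrow> solves_within p I (T (num_tools I)))"
proof (intro exI conjI allI impI)
  \<comment> \<open>A quadratic bound; \<open>n + 1\<close> keeps it positive when there are no
    tools. The logarithm only has to be at least \<open>1\<close>, which holds from
    \<open>n = 3\<close> on because \<open>exp 1 \<le> 3\<close>.\<close>
  let ?T = "\<lambda>n. 2000 * (n + 1)\<^sup>2"
  show "(\<lambda>n. real (?T n)) \<in> O(\<lambda>n. (real n)\<^sup>2 * ln (real n))"
  proof (rule bigoI, rule eventually_mono[OF eventually_ge_at_top[of 3]])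
    fix n :: nat assume n: "3 \<le> n"
    have "1 \<le> ln (real n)"
      using n exp_le by (subst ln_ge_iff) auto
    then have "(real n)\<^sup>2 * 1 \<le> (real n)\<^sup>2 * ln (real n)"
      by (intro mult_left_mono) auto
    moreover have "(real n + 1)\<^sup>2 \<le> (2 * real n)\<^sup>2" using n by (intro power_mono) auto
    ultimately have "(real n + 1)\<^sup>2 \<le> 4 * ((real n)\<^sup>2 * ln (real n))"
      by (simp add: power_mult_distrib)
    moreover have "norm ((real n)\<^sup>2 * ln (real n)) = (real n)\<^sup>2 * ln (real n)"
      using \<open>1 \<le> ln (real n)\<close> by simp
    moreover have "norm (real (?T n)) = 2000 * (real n + 1)\<^sup>2"
      by (simp add: add.commute)
    ultimately show "norm (real (?T n)) \<le> 8000 * norm ((real n)\<^sup>2 * ln (real n))"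
      by linarith
  qed
  fix I assume "valid_instance I"
  then interpret rs_instance I by unfold_locales
  show "solves_within solver I (?T (num_tools I))"
    unfolding solves_within_def using wp_solver by (simp add: wp_def)
qed

end
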